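(* Let $\Omega\subset\mathbb{R}^n$ be a bounded domain with $C^2$ boundary and $p$ a measurable function on $\Omega$. If $1<p_-\le p<\infty$ in $\Omega$, where $p_-=\inf_\Omega p$, the modular $\rho_{1,p}:W^{1,p}(\Omega)\to[0,\infty]$ defined by $\rho_{1,p}(u)=\rho_p(u)+\rho_p(|\nabla u|)$, i.e., $$\rho_{1,p}(u)=\int_\Omega\frac1p|u|^p\,dx+\int_\Omega\frac1p|\nabla u|^p\,dx,$$ is $(UC^* )$. In particular, $\rho_{1,p}$ is strictly convex, that is, for $u$ and $v$ in $W^{1,p}(\Omega)$, $u\ne v$, one has $$\rho_{1,p}\left(\frac{u+v}{2}\right)<\frac{\rho_{1,p}(u)+\rho_{1,p}(v)}{2}.$$
   Context: For a Borel measurable function $f$ on $\Omega$, $\rho_p(f)=\int_\Omega\frac{|f(x)|^{p(x)}}{p(x)}\,dx$. $W^{1,p}(\Omega)$ is the space of real-valued Borel measurable functions $u$ on $\Omega$ (identified a.e.) whose first-order distributional derivatives are Borel measurable functions and for which $\rho_{1,p}(\lambda u)<\infty$ for some $\lambda>0$; $|\nabla u|$ is the Euclidean norm of the gradient. A convex modular $\rho$ on a real vector space $V$ is a function $\rho:V\to[0,\infty]$ with $\rho(u)=0$ iff $u=0$; $\rho(\alpha u)=\rho(u)$ if $|\alpha|=1$; and $\rho(\alpha u+(1-\alpha)v)\le\alpha\rho(u)+(1-\alpha)\rho(v)$ for any $\alpha\in[0,1]$ and $u,v\in V$. It is said to be uniformly convex, written $(UC^* )$, if for every $\varepsilon>0$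 there exists $\delta=\delta(\varepsilon)>0$ such that for every $u\in V$ and $v\in V$: $$\rho\left(\frac{u-v}{2}\right)\ge\varepsilon\,\frac{\rho(u)+\rho(v)}{2}\quad\text{implies}\quad\rho\left(\frac{u+v}{2}\right)\le(1-\delta)\,\frac{\rho(u)+\rho(v)}{2}.$$
   Formalization: Strict convexity is stated only when the modular of (u+v)/2 is finite; otherwise both sides are infinite and the strict inequality fails, e.g. Ω=(0,1), p(x)=2+ln(1/x), u=8, v=7. *)

theory Defs
  imports "HOL-Analysis.Analysis"
begin

section \<open>Convex modulars\<close>

definition convex_modular :: "'v::real_vector set \<Rightarrow> ('v \<Rightarrow> ennreal) \<Rightarrow> bool" where
  "convex_modular V \<rho> \<longleftrightarrow>
     subspace V \<and>
     (\<forall>u\<in>V. \<rho> u = 0 \<longleftrightarrow> u = 0) \<and>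
     (\<forall>u\<in>V. \<forall>\<alpha>::real. \<bar>\<alpha>\<bar> = 1 \<longrightarrow> \<rho> (\<alpha> *\<^sub>R u) = \<rho> u) \<and>
     (\<forall>u\<in>V. \<forall>v\<in>V. \<forall>\<alpha>\<in>{0..1}.
        \<rho> (\<alpha> *\<^sub>R u + (1 - \<alpha>) *\<^sub>R v) \<le> ennreal \<alpha> * \<rho> u + ennreal (1 - \<alpha>) * \<rho> v)"

text \<open>
  Since \<^const>\<open>ennreal\<close> truncates at 0 and the bound gets weaker as \<open>\<delta>\<close> decreases, it makes no
  difference whether \<open>\<delta> < 1\<close> is required below.
\<close>

definition UC_star :: "'v::real_vector set \<Rightarrow> ('v \<Rightarrow> ennreal) \<Rightarrow> bool" where
  "UC_star V \<rho> \<longleftrightarrow>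
     (\<forall>\<epsilon>::real. \<epsilon> > 0 \<longrightarrow> (\<exists>\<delta>::real. \<delta> > 0 \<and> (\<forall>u\<in>V. \<forall>v\<in>V.
        \<rho> ((u - v) /\<^sub>R 2) \<ge> ennreal \<epsilon> * ((\<rho> u + \<rho> v) / 2) \<longrightarrow>
        \<rho> ((u + v) /\<^sub>R 2) \<le> ennreal (1 - \<delta>) * ((\<rho> u + \<rho> v) / 2))))"


section \<open>\<open>C\<^sup>k\<close> functions and domains with \<open>C\<^sup>k\<close> boundary\<close>

text \<open>For open \<open>S\<close> in a Euclidean space this is \<open>k\<close>-fold continuous differentiability.\<close>

primrec Ck_on :: "nat \<Rightarrow> 'a::euclidean_space set \<Rightarrow> ('a \<Rightarrow> real) \<Rightarrow> bool" where
  "Ck_on 0 S f \<longleftrightarrow> continuous_on S f"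
| "Ck_on (Suc k) S f \<longleftrightarrow>
     (\<forall>x\<in>S. f differentiable (at x)) \<and>
     (\<forall>v. Ck_on k S (\<lambda>x. frechet_derivative f (at x) v))"

text \<open>
  Near each boundary point the set is the part of a ball lying strictly above the graph of a
  \<open>C\<^sup>k\<close> function of \<open>n - 1\<close> variables, in some rotated coordinate system. Here \<open>e\<close> is the
  direction of the last coordinate axis, and a function of the remaining \<open>n - 1\<close> coordinates is a
  function \<open>\<gamma>\<close> evaluated at the orthogonal projection \<open>x - (x \<bullet> e) e\<close> onto the hyperplane
  orthogonal to \<open>e\<close>.
\<close>

definition Ck_boundary :: "nat \<Rightarrow> 'a::euclidean_space set \<Rightarrow> bool" where
  "Ck_boundary k \<Omega> \<longleftrightarrow>
     (\<forall>x0\<in>frontier \<Omega>. \<exists>r>0. \<exists>e. \<exists>\<gamma>. norm e = 1 \<and> Ck_on k UNIV \<gamma> \<and>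
        \<Omega> \<inter> ball x0 r = {x \<in> ball x0 r. x \<bullet> e > \<gamma> (x - (x \<bullet> e) *\<^sub>R e)})"


section \<open>Borel functions identified almost everywhere\<close>

quotient_type (overloaded) 'a ae_fun = "'a::euclidean_space \<Rightarrow> real" / partial:
  "\<lambda>f g. f \<in> borel_measurable borel \<and> g \<in> borel_measurable borel \<and> (AE x in lebesgue. f x = g x)"
proof (rule part_equivpI)
  show "\<exists>f::'a \<Rightarrow> real. f \<in> borel_measurable borel \<and> f \<in> borel_measurable borel \<and>
      (AE x in lebesgue. f x = f x)"
    by (intro exI[of _ "\<lambda>_. 0"]) simp
  show "symp (\<lambda>f g :: 'a \<Rightarrow> real. f \<in> borel_measurable borel \<and> g \<in> borel_measurable borel \<and>
      (AE x in lebesgue. f x = g x))"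
    by (auto intro!: sympI elim!: eventually_mono)
  show "transp (\<lambda>f g :: 'a \<Rightarrow> real. f \<in> borel_measurable borel \<and> g \<in> borel_measurable borel \<and>
      (AE x in lebesgue. f x = g x))"
    by (auto intro!: transpI elim!: eventually_elim2)
qed

instantiation ae_fun :: (euclidean_space) real_vector
begin

lift_definition zero_ae_fun :: "'a ae_fun" is "\<lambda>_. 0" by simp

lift_definition plus_ae_fun :: "'a ae_fun \<Rightarrow> 'a ae_fun \<Rightarrow> 'a ae_fun" is "\<lambda>f g x. f x + g x"
  by (auto elim!: eventually_elim2)

lift_definition uminus_ae_fun :: "'a ae_fun \<Rightarrow> 'a ae_fun" is "\<lambda>f x. - f x"
  by (auto elim!: eventually_mono)

lift_definition minus_ae_fun :: "'a ae_fun \<Rightarrow> 'a ae_fun \<Rightarrow> 'a ae_fun" is "\<lambda>f g x. f x - g x"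
  by (auto elim!: eventually_elim2)

lift_definition scaleR_ae_fun :: "real \<Rightarrow> 'a ae_fun \<Rightarrow> 'a ae_fun" is "\<lambda>c f x. c * f x"
  by (auto elim!: eventually_mono)

instance
  by (standard; transfer) (auto simp: algebra_simps)

end


section \<open>Variable exponent Sobolev spaces\<close>

definition locally_integrable_on ::
    "'a::euclidean_space set \<Rightarrow> ('a \<Rightarrow> 'b::{banach, second_countable_topology}) \<Rightarrow> bool" where
  "locally_integrable_on \<Omega> f \<longleftrightarrow> (\<forall>K. compact K \<and> K \<subseteq> \<Omega> \<longrightarrow> set_integrable lebesgue K f)"

definition test_function :: "'a::euclidean_space set \<Rightarrow> ('a \<Rightarrow> real) \<Rightarrow> bool" where
  "test_function \<Omega> \<phi> \<longleftrightarrow>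
     (\<forall>k. Ck_on k UNIV \<phi>) \<and> (\<exists>K. compact K \<and> K \<subseteq> \<Omega> \<and> (\<forall>x. x \<notin> K \<longrightarrow> \<phi> x = 0))"

definition has_weak_gradient ::
    "'a::euclidean_space set \<Rightarrow> ('a \<Rightarrow> real) \<Rightarrow> ('a \<Rightarrow> 'a) \<Rightarrow> bool" where
  "has_weak_gradient \<Omega> u g \<longleftrightarrow>
     g \<in> borel_measurable borel \<and> locally_integrable_on \<Omega> u \<and> locally_integrable_on \<Omega> g \<and>
     (\<forall>\<phi>. test_function \<Omega> \<phi> \<longrightarrow> (\<forall>b\<in>Basis.
        (LINT x:\<Omega>|lebesgue. u x * frechet_derivative \<phi> (at x) b) =
        - (LINT x:\<Omega>|lebesgue. (g x \<bullet> b) * \<phi> x)))"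

text \<open>
  For open \<open>\<Omega>\<close>, a weak gradient is unique up to a null set within \<open>\<Omega>\<close>, as is a representative
  \<^term>\<open>rep_ae_fun u\<close> of \<^term>\<open>u\<close>, and nothing below depends on the choices.
\<close>

definition weak_gradient :: "'a::euclidean_space set \<Rightarrow> 'a ae_fun \<Rightarrow> 'a \<Rightarrow> 'a" where
  "weak_gradient \<Omega> u = (SOME g. has_weak_gradient \<Omega> (rep_ae_fun u) g)"

definition rho_p :: "'a::euclidean_space set \<Rightarrow> ('a \<Rightarrow> real) \<Rightarrow> ('a \<Rightarrow> real) \<Rightarrow> ennreal" where
  "rho_p \<Omega> p f = (\<integral>\<^sup>+x\<in>\<Omega>. ennreal (\<bar>f x\<bar> powr p x / p x) \<partial>lebesgue)"

definition rho_1p :: "'a::euclidean_space set \<Rightarrow> ('a \<Rightarrow> real) \<Rightarrow> 'a ae_fun \<Rightarrow> ennreal" where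
  "rho_1p \<Omega> p u = rho_p \<Omega> p (rep_ae_fun u) + rho_p \<Omega> p (\<lambda>x. norm (weak_gradient \<Omega> u x))"

text \<open>
  A Borel function on the open set \<open>\<Omega>\<close> is represented by its extension by zero, so that the elements
  of the space are the classes that vanish almost everywhere outside \<open>\<Omega>\<close>. In particular, equality
  of two elements is equality almost everywhere in \<open>\<Omega>\<close>. The extension plays no role in the weak
  gradient, which is tested only inside \<open>\<Omega>\<close>.
\<close>

definition W_1p :: "'a::euclidean_space set \<Rightarrow> ('a \<Rightarrow> real) \<Rightarrow> 'a ae_fun set" where
  "W_1p \<Omega> p = {u.
     (AE x in lebesgue. x \<notin> \<Omega> \<longrightarrow> rep_ae_fun u x = 0) \<and>
     (\<exists>g. has_weak_gradient \<Omega> (rep_ae_fun u) g) \<and>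
     (\<exists>c>0. rho_1p \<Omega> p (c *\<^sub>R u) < \<infinity>)}"

end

theory Submission
  imports Defs
begin

text \<open>
  Everything rests on one pointwise inequality. For \<open>x\<close> and \<open>y\<close> in a real inner product space and
  every exponent \<open>p \<ge> q > 1\<close>, with \<open>M = (|x|^p + |y|^p) / 2\<close>,

    \<open>|(x + y) / 2|^p + \<delta> |(x - y) / 2|^p \<le> (1 + \<delta> \<epsilon>) M\<close>,

  where \<open>\<delta> > 0\<close> depends on \<open>q\<close> and \<open>\<epsilon>\<close> only (lemma \<open>norm_powr_uniformly_convex\<close>). For \<open>p \<ge> 2\<close>
  it follows from Clarkson's inequality. For \<open>p < 2\<close> convexity leaves a quadratic gain, a multiple of
  \<open>m^(p-2) |(x - y) / 2|^2\<close> with \<open>m = (|x| + |y|) / 2\<close>. If \<open>|(x - y) / 2| > \<epsilon> m\<close> (for \<open>\<epsilon> \<le> 1\<close>), this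
  gain dominates a multiple of \<open>|(x - y) / 2|^p\<close>; otherwise \<open>|(x - y) / 2|^p \<le> \<epsilon> M\<close>. Since \<open>\<delta>\<close>
  does not depend on \<open>p\<close>, the exponent may be unbounded.

  The inequality is linear in the powers, and its coefficients depend neither on the point nor on
  the exponent. It can therefore be divided by \<open>p x\<close>, integrated, and added up for functions
  and their gradients: the modular \<open>\<rho>\<close> satisfies the same inequality, with \<open>M = (\<rho> u + \<rho> v) / 2\<close>.
  Taken with \<open>\<epsilon> / 2\<close> for \<open>\<epsilon>\<close>, this is uniform convexity: if \<open>\<rho> ((u - v) / 2) \<ge> \<epsilon> M\<close>, then
  \<open>\<rho> ((u + v) / 2) \<le> (1 - \<delta> \<epsilon> / 2) M\<close>. Strict convexity is the case where \<open>\<epsilon>\<close> is the actual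
  ratio of \<open>\<rho> ((u - v) / 2)\<close> to \<open>M\<close>, which is positive when \<open>u \<noteq> v\<close>.

  For the gradient term, the weak gradient of a linear combination must be, almost everywhere, the
  linear combination of the weak gradients. This comes down to the uniqueness of weak gradients
  (lemma \<open>has_weak_gradient_unique\<close>), that is, to the fundamental lemma of the calculus of
  variations. Smooth functions that converge boundedly to the indicator of a box show that a
  locally integrable function orthogonal to all test functions has integral zero over every box in
  the domain; it then vanishes almost everywhere, because it is the derivative of its integral.
\<close>

section \<open>Uniform convexity of powers of a norm\<close>

text \<open>
  The derivative in \<open>s\<close> of the difference of the two sides is nonnegative: the two powers with the
  exponent \<open>q - 1 \<le> 0\<close> have product \<open>(1 - s\<^sup>2) powr (q - 1) \<ge> 1\<close>, hence sum at least \<open>2\<close>.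
\<close>
lemma powr_diff_ge_linear:
  fixes q s :: real
  assumes q: "0 < q" "q \<le> 1" and s: "0 \<le> s" "s < 1"
  shows "2 * q * s \<le> (1 + s) powr q - (1 - s) powr q"
proof -
  define g where "g = (\<lambda>t::real. (1 + t) powr q - (1 - t) powr q - 2 * q * t)"
  have "g 0 \<le> g s"
  proof (rule DERIV_nonneg_imp_nondecreasing[OF s(1)])
    fix t assume t: "0 \<le> t" "t \<le> s"
    let ?D = "q * ((1 + t) powr (q - 1) + (1 - t) powr (q - 1) - 2)"
    have D: "(g has_real_derivative ?D) (at t)"
      unfolding g_def using t s
      by (auto intro!: derivative_eq_intros simp: algebra_simps powr_diff)
    let ?A = "(1 + t) powr (q - 1)" and ?B = "(1 - t) powr (q - 1)"
    have "1 - t\<^sup>2 > 0" using t s by (simp add: power_less_one_iff abs_square_less_1)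
    moreover have "1 - t\<^sup>2 \<le> 1" by simp
    ultimately have "1 \<le> (1 - t\<^sup>2) powr (q - 1)"
      using q by (simp add: powr_mono2' [of "q - 1" "1 - t\<^sup>2" 1, simplified])
    also have "1 - t\<^sup>2 = (1 + t) * (1 - t)" by (simp add: power2_eq_square algebra_simps)
    also have "((1 + t) * (1 - t)) powr (q - 1) = ?A * ?B"
      using t s by (simp add: powr_mult)
    finally have "1 \<le> ?A * ?B" .
    moreover have "(?A + ?B)\<^sup>2 = (?A - ?B)\<^sup>2 + 4 * (?A * ?B)"
      by (simp add: power2_eq_square algebra_simps)
    ultimately have "4 \<le> (?A + ?B)\<^sup>2"
      using zero_le_power2[of "?A - ?B"] by linarith
    then have "2 \<le> ?A + ?B"
      using power2_le_imp_le[of 2 "?A + ?B"] by simp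
    then show "\<exists>y. (g has_real_derivative y) (at t) \<and> 0 \<le> y"
      using D q by (intro exI[of _ ?D]) simp
  qed
  then show ?thesis by (simp add: g_def)
qed

text \<open>
  The right side is the second-order Taylor polynomial plus further even powers of \<open>s\<close>, whose
  coefficients are nonnegative for \<open>1 < p \<le> 2\<close>. Instead of expanding, one differentiates: the
  derivative is controlled by the lemma above.
\<close>
lemma powr_mean_ge_quadratic_unit:
  fixes p s :: real
  assumes p: "1 < p" "p \<le> 2" and s: "0 \<le> s" "s \<le> 1"
  shows "1 + p * (p - 1) / 2 * s\<^sup>2 \<le> ((1 + s) powr p + (1 - s) powr p) / 2"
proof -
  define g where "g = (\<lambda>t::real. ((1 + t) powr p + (1 - t) powr p) / 2 - p * (p - 1) / 2 * t\<^sup>2)"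
  have "g 0 \<le> g s"
  proof (rule DERIV_nonneg_imp_increasing_open[OF s(1)])
    fix t assume t: "0 < t" "t < s"
    let ?D = "p / 2 * ((1 + t) powr (p - 1) - (1 - t) powr (p - 1) - 2 * (p - 1) * t)"
    have "((\<lambda>t. (1 + t) powr p) has_real_derivative p * (1 + t) powr (p - 1)) (at t)"
      "((\<lambda>t. (1 - t) powr p) has_real_derivative - p * (1 - t) powr (p - 1)) (at t)"
      using t s by (auto intro!: derivative_eq_intros simp: powr_diff)
    from DERIV_diff[OF DERIV_cdivide[OF DERIV_add[OF this], of 2]
        DERIV_cmult[OF DERIV_power[OF DERIV_ident, of 2], of "p * (p - 1) / 2"]]
    have "(g has_real_derivative ?D) (at t)"
      unfolding g_def by (rule DERIV_cong) (simp add: field_simps)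
    then show "\<exists>y. (g has_real_derivative y) (at t) \<and> 0 \<le> y"
      using powr_diff_ge_linear[of "p - 1" t] p t s by (intro exI[of _ ?D]) auto
  next
    show "continuous_on {0..s} g"
      unfolding g_def using p s by (auto intro!: continuous_intros continuous_on_powr')
  qed
  then have "1 \<le> ((1 + s) powr p + (1 - s) powr p) / 2 - p * (p - 1) / 2 * s\<^sup>2"
    by (simp add: g_def)
  then show ?thesis by linarith
qed

text \<open>
  The homogeneous form, with \<open>a = m (1 + s)\<close> and \<open>b = m (1 - s)\<close>.
\<close>
lemma powr_mean_ge_quadratic:
  fixes p a b :: real
  assumes p: "1 < p" "p \<le> 2" and ab: "0 \<le> a" "0 \<le> b"
  defines "m \<equiv> (a + b) / 2"
  shows "m powr p + p * (p - 1) / 2 * m powr (p - 2) * ((a - b) / 2)\<^sup>2 \<le> (a powr p + b powr p) / 2"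
proof -
  have *: "m powr p + p * (p - 1) / 2 * m powr (p - 2) * ((a - b) / 2)\<^sup>2 \<le> (a powr p + b powr p) / 2"
    if ab: "0 \<le> b" "b \<le> a" and m: "m = (a + b) / 2" for a b m
  proof (cases "m = 0")
    case False
    with ab m have m0: "m > 0" by auto
    define s where "s = (a - b) / 2 / m"
    have s: "0 \<le> s" "s \<le> 1" and a: "a = m * (1 + s)" and b: "b = m * (1 - s)"
      using ab m m0 by (auto simp: s_def field_simps)
    have m_powr: "m powr p = m powr (p - 2) * m\<^sup>2"
      using m0 by (simp add: powr_diff)
    have "(a - b) / 2 = m * s" by (simp add: a b algebra_simps)
    then have "m powr p + p * (p - 1) / 2 * m powr (p - 2) * ((a - b) / 2)\<^sup>2
        = m powr p * (1 + p * (p - 1) / 2 * s\<^sup>2)"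
      unfolding m_powr by (simp only: power_mult_distrib distrib_left mult_1_right mult_ac)
    also have "\<dots> \<le> m powr p * (((1 + s) powr p + (1 - s) powr p) / 2)"
      using powr_mean_ge_quadratic_unit[OF p s] by (intro mult_left_mono) auto
    also have "\<dots> = (a powr p + b powr p) / 2"
    proof -
      have "a powr p = m powr p * (1 + s) powr p" "b powr p = m powr p * (1 - s) powr p"
        using m0 s unfolding a b by (simp_all add: powr_mult)
      then show ?thesis by (simp add: distrib_left)
    qed
    finally show ?thesis .
  qed (use ab m in auto)
  show ?thesis
  proof (cases "b \<le> a")
    case True
    then show ?thesis using *[of b a m] ab by (simp add: m_def)
  next
    case False
    then show ?thesis using *[of a b m] ab by (simp add: m_def add.commute power_divide power2_commute[of a b])
  qed
qed

lemma powr_convex_nonneg: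
  fixes p t x y :: real
  assumes p: "1 \<le> p" and t: "0 \<le> t" "t \<le> 1" and xy: "0 \<le> x" "0 \<le> y"
  shows "(t * x + (1 - t) * y) powr p \<le> t * x powr p + (1 - t) * y powr p"
proof -
  have scale: "(c * z) powr p \<le> c * z powr p" if "0 \<le> c" "c \<le> 1" "0 \<le> z" for c z :: real
    using powr_mono'[of 1 p c] that p by (simp add: powr_mult mult_right_mono)
  consider "x = 0" | "y = 0" | "0 < x" "0 < y" using xy by fastforce
  then show ?thesis
  proof cases
    case 3
    then show ?thesis using convex_onD[OF powr_convex[OF p], of "1 - t" x y] t by simp
  qed (use scale t xy p in auto)
qed

text \<open>
  A concave function lies below its tangent; Young's inequality is this bound at \<open>x = 1\<close>.
\<close>
lemma powr_le_tangent:
  fixes r x y :: real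
  assumes r: "0 < r" "r \<le> 1" and "0 < x" "0 \<le> y"
  shows "y powr r \<le> x powr r + r * x powr (r - 1) * (y - x)"
proof -
  have "(y / x) powr r \<le> 1 + r * (y / x - 1)"
    using Youngs_inequality_0[of r "1 - r" "y / x" 1] r assms
    by (cases "y = 0") (auto simp: algebra_simps)
  then have "x powr r * (y / x) powr r \<le> x powr r * (1 + r * (y / x - 1))"
    by (intro mult_left_mono) auto
  then show ?thesis
    using assms by (simp add: powr_divide powr_diff field_simps)
qed

text \<open>
  By the parallelogram law the squares of the two norms on the left add up to the mean of
  \<open>(norm x)\<^sup>2\<close> and \<open>(norm y)\<^sup>2\<close>. Then \<open>\<lambda>t. t powr (p / 2)\<close> is superadditive, which gives the
  first estimate, and convex, which gives the second.
\<close>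
lemma clarkson_inequality_inner:
  fixes x y :: "'a::real_inner"
  assumes p: "2 \<le> p"
  shows "norm ((x + y) /\<^sub>R 2) powr p + norm ((x - y) /\<^sub>R 2) powr p \<le> (norm x powr p + norm y powr p) / 2"
proof -
  let ?A = "(norm ((x + y) /\<^sub>R 2))\<^sup>2" and ?D = "(norm ((x - y) /\<^sub>R 2))\<^sup>2"
  have sq: "t powr p = (t\<^sup>2) powr (p / 2)" if "t \<ge> 0" for t :: real
    using that by (cases "t = 0") (auto simp: powr_power powr_powr simp flip: powr_numeral)
  have sum: "?A + ?D = ((norm x)\<^sup>2 + (norm y)\<^sup>2) / 2"
    by (simp add: power_mult_distrib power_divide)
       (simp add: power2_norm_eq_inner inner_simps inner_commute field_simps)
  have super: "s powr r + t powr r \<le> (s + t) powr r" if "0 \<le> s" "0 \<le> t" "1 \<le> r" for s t r :: real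
  proof (cases "s + t = 0")
    case False
    then have st: "s + t > 0" using that by simp
    have le: "z powr r \<le> z" if "0 \<le> z" "z \<le> 1" for z :: real
      using powr_mono'[of 1 r z] that \<open>1 \<le> r\<close> by simp
    have "(s / (s + t)) powr r + (t / (s + t)) powr r \<le> s / (s + t) + t / (s + t)"
      using that st by (intro add_mono le) auto
    also have "\<dots> = 1" using st by (simp flip: add_divide_distrib)
    finally show ?thesis using st that by (simp add: powr_divide field_simps)
  next
    case True
    then have "s = 0" "t = 0" using that by auto
    then show ?thesis by simp
  qed
  have "norm ((x + y) /\<^sub>R 2) powr p + norm ((x - y) /\<^sub>R 2) powr p \<le> (?A + ?D) powr (p / 2)"
    unfolding sq[OF norm_ge_zero] using p by (intro super) auto
  also have "\<dots> \<le> ((norm x)\<^sup>2 powr (p / 2) + (norm y)\<^sup>2 powr (p / 2)) / 2"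
    unfolding sum using powr_convex_nonneg[of "p/2" "1/2" "(norm x)\<^sup>2" "(norm y)\<^sup>2"] p
    by (simp add: field_simps)
  finally show ?thesis by (simp only: sq[OF norm_ge_zero])
qed

text \<open>
  Let \<open>m\<close> be the mean of the two norms. The parallelogram law gives
  \<open>(norm ((x + y) /\<^sub>R 2))\<^sup>2 = m\<^sup>2 - r\<close>, where \<open>r\<close> is the part of \<open>(norm ((x - y) /\<^sub>R 2))\<^sup>2\<close> that is
  not accounted for by the difference of the norms. The tangent to \<open>\<lambda>t. t powr (p / 2)\<close> at \<open>m\<^sup>2\<close>
  turns \<open>r\<close> into a gain, and the scalar inequality for the numbers \<open>norm x\<close> and \<open>norm y\<close> supplies
  the rest. Since \<open>p - 1 \<le> 1\<close>, both gains carry at least the factor \<open>p (p - 1) / 2\<close>, and they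
  add up to the full square.
\<close>
lemma norm_powr_midpoint_le_quadratic:
  fixes x y :: "'a::real_inner"
  assumes p: "1 < p" "p \<le> 2"
  shows "norm ((x + y) /\<^sub>R 2) powr p +
      p * (p - 1) / 2 * ((norm x + norm y) / 2) powr (p - 2) * (norm ((x - y) /\<^sub>R 2))\<^sup>2
    \<le> (norm x powr p + norm y powr p) / 2"
proof (cases "x = 0 \<and> y = 0")
  case False
  define m where "m = (norm x + norm y) / 2"
  define d where "d = norm ((x - y) /\<^sub>R 2)"
  define r where "r = d\<^sup>2 - ((norm x - norm y) / 2)\<^sup>2"
  have m: "m > 0" using False by (auto simp: m_def add_pos_nonneg add_nonneg_pos)
  have sq: "(t\<^sup>2) powr (z / 2) = t powr z" if "t \<ge> 0" for t z :: real
    using that by (cases "t = 0") (auto simp: powr_power powr_powr simp flip: powr_numeral)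
  have A: "(norm ((x + y) /\<^sub>R 2))\<^sup>2 = m\<^sup>2 - r"
    unfolding m_def r_def d_def
    by (simp add: power2_norm_eq_inner inner_simps inner_commute power_divide power2_sum power2_diff)
       (simp add: power2_norm_eq_inner field_simps)
  have "\<bar>norm x - norm y\<bar> \<le> norm (x - y)" by (rule norm_triangle_ineq3)
  then have "((norm x - norm y) / 2)\<^sup>2 \<le> d\<^sup>2"
    unfolding d_def by (intro abs_le_square_iff[THEN iffD1]) auto
  then have r: "0 \<le> r" by (simp add: r_def)
  have "norm ((x + y) /\<^sub>R 2) powr p = (m\<^sup>2 - r) powr (p / 2)"
    unfolding A[symmetric] by (simp add: sq)
  also have "\<dots> \<le> (m\<^sup>2) powr (p / 2) + p / 2 * (m\<^sup>2) powr (p / 2 - 1) * ((m\<^sup>2 - r) - m\<^sup>2)"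
    using p m A by (intro powr_le_tangent) (auto simp flip: A)
  also have "\<dots> = m powr p - p / 2 * m powr (p - 2) * r"
    using m sq[of m "p - 2"] by (simp add: sq diff_divide_distrib)
  also have "\<dots> \<le> m powr p - p * (p - 1) / 2 * m powr (p - 2) * r"
  proof -
    have "p * (p - 1) \<le> p * 1" using p by (intro mult_left_mono) auto
    then have "p * (p - 1) / 2 * (m powr (p - 2) * r) \<le> p / 2 * (m powr (p - 2) * r)"
      using r by (intro mult_right_mono) auto
    then show ?thesis by (simp add: mult.assoc)
  qed
  finally have "norm ((x + y) /\<^sub>R 2) powr p \<le> m powr p - p * (p - 1) / 2 * m powr (p - 2) * r" .
  moreover have "m powr p + p * (p - 1) / 2 * m powr (p - 2) * ((norm x - norm y) / 2)\<^sup>2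
      \<le> (norm x powr p + norm y powr p) / 2"
    unfolding m_def using p by (intro powr_mean_ge_quadratic) auto
  moreover have "p * (p - 1) / 2 * m powr (p - 2) * r + p * (p - 1) / 2 * m powr (p - 2) * ((norm x - norm y) / 2)\<^sup>2
      = p * (p - 1) / 2 * m powr (p - 2) * d\<^sup>2"
    unfolding r_def by (simp only: flip: distrib_left) simp
  ultimately show ?thesis
    unfolding m_def[symmetric] d_def[symmetric] by linarith
qed auto

lemma norm_powr_convex:
  fixes x y :: "'a::real_normed_vector"
  assumes p: "1 \<le> p" and \<alpha>: "0 \<le> \<alpha>" "\<alpha> \<le> 1"
  shows "norm (\<alpha> *\<^sub>R x + (1 - \<alpha>) *\<^sub>R y) powr p \<le> \<alpha> * norm x powr p + (1 - \<alpha>) * norm y powr p"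
proof -
  have "norm (\<alpha> *\<^sub>R x + (1 - \<alpha>) *\<^sub>R y) \<le> \<alpha> * norm x + (1 - \<alpha>) * norm y"
    using norm_triangle_ineq[of "\<alpha> *\<^sub>R x" "(1 - \<alpha>) *\<^sub>R y"] \<alpha> by simp
  then have "norm (\<alpha> *\<^sub>R x + (1 - \<alpha>) *\<^sub>R y) powr p \<le> (\<alpha> * norm x + (1 - \<alpha>) * norm y) powr p"
    using p by (intro powr_mono2) auto
  also have "\<dots> \<le> \<alpha> * norm x powr p + (1 - \<alpha>) * norm y powr p"
    using powr_convex_nonneg[OF p] \<alpha> by simp
  finally show ?thesis .
qed

text \<open>
  The constant is explicit because the same one has to serve for real values and for gradients,
  which live in different types.
\<close>
definition convexity_gain :: "real \<Rightarrow> real \<Rightarrow> real" where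
  "convexity_gain q \<epsilon> = min 1 (q * (q - 1) / 2 * min \<epsilon> 1)"

lemma convexity_gain_pos: "1 < q \<Longrightarrow> 0 < \<epsilon> \<Longrightarrow> 0 < convexity_gain q \<epsilon>"
  by (simp add: convexity_gain_def)

text \<open>
  The bound is uniform in \<open>p \<ge> q\<close> and linear in the four powers, so it survives integration with an
  exponent that varies from point to point.
\<close>
lemma norm_powr_uniformly_convex:
  fixes q p \<epsilon> :: real and x y :: "'a::real_inner"
  assumes q: "1 < q" and \<epsilon>: "0 < \<epsilon>" and qp: "q \<le> p"
  defines "\<delta> \<equiv> convexity_gain q \<epsilon>"
  shows "norm ((x + y) /\<^sub>R 2) powr p + \<delta> * norm ((x - y) /\<^sub>R 2) powr p
      \<le> (1 + \<delta> * \<epsilon>) * ((norm x powr p + norm y powr p) / 2)"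
proof -
  define e where "e = min \<epsilon> 1"
  have e: "0 < e" "e \<le> 1" "e \<le> \<epsilon>" using \<epsilon> by (auto simp: e_def)
  have \<delta>: "0 < \<delta>" "\<delta> \<le> 1" "\<delta> \<le> q * (q - 1) / 2 * e"
    unfolding \<delta>_def by (rule convexity_gain_pos[OF q \<epsilon>])
      (unfold convexity_gain_def e_def, rule min.cobounded1, rule min.cobounded2)
  define A where "A = norm ((x + y) /\<^sub>R 2) powr p"
  define d where "d = norm ((x - y) /\<^sub>R 2)"
  define m where "m = (norm x + norm y) / 2"
  define avg where "avg = (norm x powr p + norm y powr p) / 2"
  have pos: "0 \<le> d" "0 \<le> m" "0 \<le> avg" by (auto simp: d_def m_def avg_def)
  have A_le: "A \<le> avg"
    using norm_powr_convex[of p "1/2" x y] q qp by (simp add: A_def avg_def scaleR_add_right)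
  have m_le: "m powr p \<le> avg"
    using norm_powr_convex[of p "1/2" "norm x" "norm y"] q qp by (simp add: m_def avg_def field_simps)
  have weaken: "A + \<delta> * d powr p \<le> (1 + \<delta> * \<epsilon>) * avg" if "A + \<delta> * d powr p \<le> avg"
  proof -
    have "0 \<le> \<delta> * \<epsilon> * avg" using \<delta> \<epsilon> pos by simp
    then show ?thesis using that unfolding distrib_right by linarith
  qed
  have "A + \<delta> * d powr p \<le> (1 + \<delta> * \<epsilon>) * avg"
  proof (cases "2 \<le> p")
    case True
    have "A + d powr p \<le> avg"
      unfolding A_def d_def avg_def by (rule clarkson_inequality_inner[OF True])
    moreover have "\<delta> * d powr p \<le> 1 * d powr p" using \<delta> by (intro mult_right_mono) auto
    ultimately show ?thesis by (intro weaken) auto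
  next
    case False
    then have p: "1 < p" "p \<le> 2" using q qp by auto
    show ?thesis
    proof (cases "d \<le> e * m")
      case True
      then have "d powr p \<le> (e * m) powr p" using pos p by (intro powr_mono2) auto
      also have "\<dots> = e powr p * m powr p" using e pos by (simp add: powr_mult)
      also have "\<dots> \<le> \<epsilon> * avg"
      proof (intro mult_mono m_le)
        show "e powr p \<le> \<epsilon>" using powr_mono'[of 1 p e] p e by simp
      qed (use \<epsilon> in auto)
      finally have "\<delta> * d powr p \<le> \<delta> * (\<epsilon> * avg)" using \<delta> by (intro mult_left_mono) auto
      then show ?thesis using A_le by (simp add: algebra_simps)
    next
      case False
      then have d: "0 < d" using e pos by (meson le_less_trans mult_nonneg_nonneg less_imp_le not_le)
      have m0: "0 < m"
      proof (rule ccontr)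
        assume "\<not> 0 < m"
        then have "norm x + norm y \<le> 0" using pos by (simp add: m_def)
        then have "x = 0 \<and> y = 0" using norm_ge_zero[of x] norm_ge_zero[of y] norm_le_zero_iff by (smt (verit))
        then show False using d by (simp add: d_def)
      qed
      have "e \<le> e powr (2 - p)" using powr_mono'[of "2 - p" 1 e] p e by simp
      then have "e * d powr (p - 2) \<le> e powr (2 - p) * d powr (p - 2)" by (intro mult_right_mono) auto
      also have "\<dots> = (d / e) powr (p - 2)"
        using d e by (simp add: powr_divide) (simp add: powr_minus_divide[of e "p-2", simplified])
      also have "\<dots> \<le> m powr (p - 2)"
        using p d m0 e False by (intro powr_mono2') (auto simp: field_simps)
      finally have "e * d powr (p - 2) \<le> m powr (p - 2)" .
      then have "e * d powr (p - 2) * d\<^sup>2 \<le> m powr (p - 2) * d\<^sup>2" by (intro mult_right_mono) auto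
      then have ed: "e * d powr p \<le> m powr (p - 2) * d\<^sup>2" using d by (simp add: powr_diff)
      have "q * (q - 1) \<le> p * (p - 1)" using q qp by (intro mult_mono) auto
      then have "q * (q - 1) / 2 * (e * d powr p) \<le> p * (p - 1) / 2 * (m powr (p - 2) * d\<^sup>2)"
        using ed q e qp by (intro mult_mono[OF divide_right_mono ed]) auto
      moreover have "\<delta> * d powr p \<le> q * (q - 1) / 2 * e * d powr p"
        using \<delta> by (intro mult_right_mono) auto
      moreover have "A + p * (p - 1) / 2 * m powr (p - 2) * d\<^sup>2 \<le> avg"
        unfolding A_def d_def m_def avg_def by (rule norm_powr_midpoint_le_quadratic[OF p])
      ultimately show ?thesis by (intro weaken) (simp add: mult.assoc)
    qed
  qed
  then show ?thesis
    by (simp add: A_def d_def avg_def)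
qed

section \<open>Uniformly convex modulars and the modular of a variable exponent\<close>

lemma ennreal_half: "(x::ennreal) / 2 = ennreal (1 / 2) * x"
proof -
  have "ennreal (1 / 2) = 1 / 2" using divide_ennreal[of 1 2] by simp
  then show ?thesis by (simp add: ennreal_times_divide mult.commute)
qed

text \<open>
  Apply the hypothesis with \<open>\<epsilon> / 2\<close>: if the modular of the half difference is at least \<open>\<epsilon>\<close> times
  the mean \<open>a\<close>, then subtracting \<open>\<delta> \<epsilon> a\<close> from \<open>(1 + \<delta> \<epsilon> / 2) a\<close> leaves \<open>(1 - \<delta> \<epsilon> / 2) a\<close>.
\<close>
lemma UC_star_of_modulus_inequality:
  fixes \<rho> :: "'v::real_vector \<Rightarrow> ennreal"
  assumes "\<And>\<epsilon>::real. 0 < \<epsilon> \<Longrightarrow> \<exists>\<delta>>0. \<forall>u\<in>V. \<forall>v\<in>V.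
      \<rho> ((u + v) /\<^sub>R 2) + ennreal \<delta> * \<rho> ((u - v) /\<^sub>R 2) \<le> ennreal (1 + \<delta> * \<epsilon>) * ((\<rho> u + \<rho> v) / 2)"
  shows "UC_star V \<rho>"
  unfolding UC_star_def
proof (intro allI impI)
  fix \<epsilon> :: real
  assume \<epsilon>: "0 < \<epsilon>"
  obtain \<delta> :: real where \<delta>: "0 < \<delta>" and ineq: "\<And>u v. u \<in> V \<Longrightarrow> v \<in> V \<Longrightarrow>
      \<rho> ((u + v) /\<^sub>R 2) + ennreal \<delta> * \<rho> ((u - v) /\<^sub>R 2) \<le> ennreal (1 + \<delta> * (\<epsilon> / 2)) * ((\<rho> u + \<rho> v) / 2)"
    using assms[of "\<epsilon> / 2"] \<epsilon> by auto
  (* Keeping d below 1 makes the right-hand side infinite when the mean is. *)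
  define d where "d = min (1 / 2) (\<delta> * \<epsilon> / 2)"
  have d: "0 < d" "d \<le> 1 / 2" "d \<le> \<delta> * \<epsilon> / 2" using \<delta> \<epsilon> by (auto simp: d_def)
  have "\<rho> ((u + v) /\<^sub>R 2) \<le> ennreal (1 - d) * ((\<rho> u + \<rho> v) / 2)"
    if uv: "u \<in> V" "v \<in> V" and far: "ennreal \<epsilon> * ((\<rho> u + \<rho> v) / 2) \<le> \<rho> ((u - v) /\<^sub>R 2)" for u v
  proof (cases "(\<rho> u + \<rho> v) / 2 = \<infinity>")
    case True
    then show ?thesis using d by (simp add: ennreal_mult_top)
  next
    case False
    then obtain a where a: "0 \<le> a" "(\<rho> u + \<rho> v) / 2 = ennreal a" by (cases "(\<rho> u + \<rho> v) / 2") auto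
    have le: "\<rho> ((u + v) /\<^sub>R 2) + ennreal \<delta> * \<rho> ((u - v) /\<^sub>R 2) \<le> ennreal ((1 + \<delta> * (\<epsilon> / 2)) * a)"
      using ineq[OF uv] a \<delta> \<epsilon> by (simp add: ennreal_mult)
    have "ennreal \<delta> * ennreal (\<epsilon> * a) \<le> ennreal \<delta> * \<rho> ((u - v) /\<^sub>R 2)"
      using far a \<epsilon> by (intro mult_left_mono) (auto simp: ennreal_mult)
    then have "\<rho> ((u + v) /\<^sub>R 2) + ennreal (\<delta> * (\<epsilon> * a)) \<le> ennreal ((1 + \<delta> * (\<epsilon> / 2)) * a)"
      using a \<delta> \<epsilon> by (intro order_trans[OF _ le] add_left_mono) (simp add: ennreal_mult)
    moreover from this obtain r where r: "0 \<le> r" "\<rho> ((u + v) /\<^sub>R 2) = ennreal r"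
      by (cases "\<rho> ((u + v) /\<^sub>R 2)") (auto simp: top_unique)
    moreover have "0 \<le> \<delta> * (\<epsilon> * a)" "0 \<le> (1 + \<delta> * (\<epsilon> / 2)) * a" using a \<delta> \<epsilon> by auto
    ultimately have "r + \<delta> * (\<epsilon> * a) \<le> (1 + \<delta> * (\<epsilon> / 2)) * a"
      by (metis ennreal_le_iff ennreal_plus)
    then have "\<rho> ((u + v) /\<^sub>R 2) \<le> ennreal ((1 + \<delta> * (\<epsilon> / 2)) * a - \<delta> * (\<epsilon> * a))"
      unfolding r by (intro ennreal_leI) linarith
    also have "\<dots> \<le> ennreal ((1 - d) * a)"
      using mult_right_mono[OF d(3) a(1)] by (intro ennreal_leI) (simp add: algebra_simps)
    also have "\<dots> = ennreal (1 - d) * ((\<rho> u + \<rho> v) / 2)"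
      using a d by (simp add: ennreal_mult)
    finally show ?thesis .
  qed
  then show "\<exists>\<delta>>0. \<forall>u\<in>V. \<forall>v\<in>V. ennreal \<epsilon> * ((\<rho> u + \<rho> v) / 2) \<le> \<rho> ((u - v) /\<^sub>R 2) \<longrightarrow>
      \<rho> ((u + v) /\<^sub>R 2) \<le> ennreal (1 - \<delta>) * ((\<rho> u + \<rho> v) / 2)"
    using d(1) by (intro exI[of _ d]) blast
qed

text \<open>
  For \<open>u \<noteq> v\<close> and a finite mean \<open>a\<close>, the modular \<open>b\<close> of the half difference is positive and finite,
  so uniform convexity applies with \<open>\<epsilon> = b / a\<close>.
\<close>
lemma UC_star_imp_strictly_convex:
  assumes modular: "convex_modular V \<rho>" and UC: "UC_star V \<rho>"
    and uv: "u \<in> V" "v \<in> V" "u \<noteq> v" and fin: "\<rho> ((u + v) /\<^sub>R 2) < \<infinity>"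
  shows "\<rho> ((u + v) /\<^sub>R 2) < (\<rho> u + \<rho> v) / 2"
proof (cases "(\<rho> u + \<rho> v) / 2 = \<infinity>")
  case True
  then show ?thesis using fin by simp
next
  case False
  have V: "subspace V" using modular by (simp add: convex_modular_def)
  have mem: "(u - v) /\<^sub>R 2 \<in> V" and neg: "- v \<in> V"
    using V uv by (auto intro: subspace_diff subspace_scale subspace_neg)
  have "\<forall>u\<in>V. \<forall>\<alpha>::real. \<bar>\<alpha>\<bar> = 1 \<longrightarrow> \<rho> (\<alpha> *\<^sub>R u) = \<rho> u"
    using modular by (simp add: convex_modular_def)
  from this[rule_format, of v "-1"] uv have "\<rho> (- v) = \<rho> v" by simp
  moreover have "\<forall>u\<in>V. \<forall>v\<in>V. \<forall>\<alpha>\<in>{0..1}.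
      \<rho> (\<alpha> *\<^sub>R u + (1 - \<alpha>) *\<^sub>R v) \<le> ennreal \<alpha> * \<rho> u + ennreal (1 - \<alpha>) * \<rho> v"
    using modular by (simp add: convex_modular_def)
  from this[rule_format, OF uv(1) neg, of "1 / 2"]
  have "\<rho> ((u - v) /\<^sub>R 2) \<le> ennreal (1 / 2) * \<rho> u + ennreal (1 / 2) * \<rho> (- v)"
    by (simp add: scaleR_diff_right)
  ultimately have le: "\<rho> ((u - v) /\<^sub>R 2) \<le> (\<rho> u + \<rho> v) / 2"
    by (simp add: ennreal_half distrib_left)
  have "\<rho> ((u - v) /\<^sub>R 2) \<noteq> 0"
    using modular mem uv(3) by (simp add: convex_modular_def)
  with le False obtain a b where ab: "(\<rho> u + \<rho> v) / 2 = ennreal a" "\<rho> ((u - v) /\<^sub>R 2) = ennreal b"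
      "0 < b" "b \<le> a"
    by (cases "(\<rho> u + \<rho> v) / 2"; cases "\<rho> ((u - v) /\<^sub>R 2)") (auto simp: top_unique less_le)
  have ratio: "0 < b / a" using ab(3,4) by simp
  obtain \<delta> where \<delta>: "0 < \<delta>" and imp: "ennreal (b / a) * ((\<rho> u + \<rho> v) / 2) \<le> \<rho> ((u - v) /\<^sub>R 2) \<Longrightarrow>
      \<rho> ((u + v) /\<^sub>R 2) \<le> ennreal (1 - \<delta>) * ((\<rho> u + \<rho> v) / 2)"
    using UC[unfolded UC_star_def, rule_format, OF ratio] uv by blast
  have "ennreal (b / a) * ennreal a = ennreal b"
    using ab(3,4) by (simp flip: ennreal_mult)
  then have "\<rho> ((u + v) /\<^sub>R 2) \<le> ennreal (1 - \<delta>) * ennreal a"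
    using imp ab by simp
  also have "\<dots> = ennreal ((1 - \<delta>) * a)"
    using ab(3,4) by (simp add: ennreal_mult'')
  also have "\<dots> < ennreal a"
    using ab(3,4) \<delta> by (intro ennreal_lessI) (auto simp: algebra_simps)
  finally show ?thesis by (simp add: ab)
qed

lemma rho_p_integrand_measurable:
  assumes [measurable]: "\<Omega> \<in> sets lebesgue" and p: "p \<in> borel_measurable (lebesgue_on \<Omega>)"
    and f: "f \<in> borel_measurable borel"
  shows "(\<lambda>x. ennreal (\<bar>f x\<bar> powr p x / p x) * indicator \<Omega> x) \<in> borel_measurable lebesgue"
proof -
  have "f \<in> borel_measurable lebesgue"
    using f by (simp add: measurable_completion)
  then have [measurable]: "f \<in> borel_measurable (lebesgue_on \<Omega>)"
    by (rule measurable_restrict_space1)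
  note p[measurable]
  have "(\<lambda>x. ennreal (\<bar>f x\<bar> powr p x / p x)) \<in> borel_measurable (lebesgue_on \<Omega>)"
    by measurable
  then show ?thesis by (subst (asm) borel_measurable_restrict_space_iff_ennreal) auto
qed

text \<open>
  The coefficients are constants, so a pointwise inequality between powers passes to the
  modulars.
\<close>
lemma rho_p_linear_mono:
  fixes F1 F2 G1 G2 :: "'a::euclidean_space \<Rightarrow> real"
  assumes \<Omega>: "\<Omega> \<in> sets lebesgue" and p: "p \<in> borel_measurable (lebesgue_on \<Omega>)"
    and pos: "\<And>x. x \<in> \<Omega> \<Longrightarrow> 0 < p x"
    and meas: "F1 \<in> borel_measurable borel" "F2 \<in> borel_measurable borel"
      "G1 \<in> borel_measurable borel" "G2 \<in> borel_measurable borel"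
    and coeff: "0 \<le> a" "0 \<le> b" "0 \<le> c" "0 \<le> d"
    and le: "AE x in lebesgue. x \<in> \<Omega> \<longrightarrow>
      a * \<bar>F1 x\<bar> powr p x + b * \<bar>F2 x\<bar> powr p x \<le> c * \<bar>G1 x\<bar> powr p x + d * \<bar>G2 x\<bar> powr p x"
  shows "ennreal a * rho_p \<Omega> p F1 + ennreal b * rho_p \<Omega> p F2
    \<le> ennreal c * rho_p \<Omega> p G1 + ennreal d * rho_p \<Omega> p G2"
proof -
  let ?I = "\<lambda>f x. ennreal (\<bar>f x\<bar> powr p x / p x) * indicator \<Omega> x"
  note [measurable] = meas[THEN rho_p_integrand_measurable[OF \<Omega> p]]
  have "(\<integral>\<^sup>+x. ennreal a * ?I F1 x + ennreal b * ?I F2 x \<partial>lebesgue)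
      \<le> (\<integral>\<^sup>+x. ennreal c * ?I G1 x + ennreal d * ?I G2 x \<partial>lebesgue)"
  proof (rule nn_integral_mono_AE, use le in eventually_elim)
    fix x
    assume *: "x \<in> \<Omega> \<longrightarrow>
      a * \<bar>F1 x\<bar> powr p x + b * \<bar>F2 x\<bar> powr p x \<le> c * \<bar>G1 x\<bar> powr p x + d * \<bar>G2 x\<bar> powr p x"
    show "ennreal a * ?I F1 x + ennreal b * ?I F2 x \<le> ennreal c * ?I G1 x + ennreal d * ?I G2 x"
    proof (cases "x \<in> \<Omega>")
      case True
      have "(a * \<bar>F1 x\<bar> powr p x + b * \<bar>F2 x\<bar> powr p x) / p x \<le> (c * \<bar>G1 x\<bar> powr p x + d * \<bar>G2 x\<bar> powr p x) / p x"
        using * pos[OF True] True by (intro divide_right_mono) auto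
      then show ?thesis
        using True coeff pos[OF True]
        by (simp add: add_divide_distrib ennreal_leI flip: ennreal_mult ennreal_plus)
    qed simp
  qed
  then show ?thesis
    unfolding rho_p_def by (simp add: nn_integral_add nn_integral_cmult)
qed

lemma rho_p_eq_0_iff:
  assumes \<Omega>: "\<Omega> \<in> sets lebesgue" and p: "p \<in> borel_measurable (lebesgue_on \<Omega>)"
    and pos: "\<And>x. x \<in> \<Omega> \<Longrightarrow> 0 < p x"
    and f: "f \<in> borel_measurable borel"
  shows "rho_p \<Omega> p f = 0 \<longleftrightarrow> (AE x in lebesgue. x \<in> \<Omega> \<longrightarrow> f x = 0)"
proof -
  note [measurable] = rho_p_integrand_measurable[OF \<Omega> p f]
  show ?thesis
    unfolding rho_p_def nn_integral_0_iff_AE[OF rho_p_integrand_measurable[OF \<Omega> p f]]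
  proof (intro AE_cong)
    fix x
    show "ennreal (\<bar>f x\<bar> powr p x / p x) * indicator \<Omega> x = 0 \<longleftrightarrow> (x \<in> \<Omega> \<longrightarrow> f x = 0)"
      using pos[of x] by (auto simp: indicator_def ennreal_eq_0_iff divide_le_0_iff split: if_splits)
  qed
qed

section \<open>Smooth bump functions on boxes\<close>

text \<open>
  The functions \<open>t^(-j) exp (-1/t)\<close>, extended by zero, form a family whose linear span is closed under
  differentiation; \<open>flat 0\<close> is the classical smooth function that is flat at the origin.
\<close>
definition flat :: "nat \<Rightarrow> real \<Rightarrow> real" where
  "flat j t = (if 0 < t then exp (- 1 / t) / t ^ j else 0)"

lemma flat_tendsto_0_right: "(flat j \<longlongrightarrow> 0) (at_right 0)"
proof -
  have "((\<lambda>t. inverse t ^ j / exp (inverse t)) \<longlongrightarrow> (0::real)) (at_right 0)"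
    using tendsto_power_div_exp_0 filterlim_inverse_at_top_right by (rule filterlim_compose)
  then show ?thesis
  proof (rule Lim_transform_eventually)
    show "\<forall>\<^sub>F t in at_right 0. inverse t ^ j / exp (inverse t) = flat j t"
      unfolding eventually_at_filter flat_def
      by (intro always_eventually) (auto simp: field_simps exp_minus)
  qed
qed

lemma flat_has_derivative:
  "(flat j has_real_derivative flat (j + 2) t - real j * flat (Suc j) t) (at t)"
proof -
  consider "0 < t" | "t < 0" | "t = 0" by linarith
  then show ?thesis
  proof cases
    case 1
    have "((\<lambda>t. exp (- 1 / t) / t ^ j) has_real_derivative
        exp (- 1 / t) / t ^ (j + 2) - real j * (exp (- 1 / t) / t ^ Suc j)) (at t)"
    proof (cases j)
      case 0
      then show ?thesis using 1
        by (auto intro!: derivative_eq_intros simp: power2_eq_square)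
    next
      case (Suc k)
      then show ?thesis using 1
        by (auto intro!: derivative_eq_intros simp: divide_simps power2_eq_square)
          (cases k; simp add: algebra_simps)
    qed
    then have "((\<lambda>t. exp (- 1 / t) / t ^ j) has_real_derivative flat (j + 2) t - real j * flat (Suc j) t) (at t)"
      using 1 by (simp add: flat_def)
    then show ?thesis
      by (rule has_field_derivative_transform_within_open[of _ _ _ "{0<..}"]) (use 1 in \<open>auto simp: flat_def\<close>)
  next
    case 2
    have "((\<lambda>_. 0) has_real_derivative 0) (at t)" by simp
    then have "(flat j has_real_derivative 0) (at t)"
      by (rule has_field_derivative_transform_within_open[of _ _ _ "{..<0}"]) (use 2 in \<open>auto simp: flat_def\<close>)
    then show ?thesis using 2 by (simp add: flat_def)
  next
    case 3
    have "\<forall>\<^sub>F h in at_left 0. (0::real) = flat (Suc j) h"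
      unfolding eventually_at_filter flat_def by (intro always_eventually) auto
    then have "(flat (Suc j) \<longlongrightarrow> 0) (at_left 0)"
      by (rule Lim_transform_eventually[OF tendsto_const])
    then have "flat (Suc j) \<midarrow>0\<rightarrow> 0"
      using flat_tendsto_0_right by (rule filterlim_split_at)
    (* At the origin the difference quotient of a flat function is the next one of the family. *)
    moreover have "flat (Suc j) = (\<lambda>h. (flat j (0 + h) - flat j 0) / h)"
      by (simp add: flat_def fun_eq_iff)
    ultimately have "(flat j has_real_derivative 0) (at 0)"
      unfolding DERIV_def by argo
    then show ?thesis using 3 by (simp add: flat_def)
  qed
qed

text \<open>
  Smoothness follows from membership in an algebra of functions that is closed under directional
  derivatives; no derivative of higher order has to be computed.
\<close>
inductive flat_algebra :: "('a::euclidean_space \<Rightarrow> real) \<Rightarrow> bool" where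
  const: "flat_algebra (\<lambda>_. c)"
| flat: "flat_algebra (\<lambda>x. flat j (x \<bullet> w + d))"
| add: "flat_algebra f \<Longrightarrow> flat_algebra g \<Longrightarrow> flat_algebra (\<lambda>x. f x + g x)"
| mult: "flat_algebra f \<Longrightarrow> flat_algebra g \<Longrightarrow> flat_algebra (\<lambda>x. f x * g x)"

lemma flat_algebra_has_derivative:
  assumes "flat_algebra f"
  shows "\<exists>D. (\<forall>x. (f has_derivative (\<lambda>v. D v x)) (at x)) \<and> (\<forall>v. flat_algebra (D v))"
  using assms
proof induction
  case (const c)
  show ?case
    by (intro exI[of _ "\<lambda>v x. 0"]) (auto intro: flat_algebra.const)
next
  case (flat j w d)
  let ?D = "\<lambda>v x. (v \<bullet> w) * (flat (j + 2) (x \<bullet> w + d) + - real j * flat (Suc j) (x \<bullet> w + d))"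
  have "((\<lambda>x. flat j (x \<bullet> w + d)) has_derivative (\<lambda>v. ?D v x)) (at x)" for x
  proof -
    have "((\<lambda>x. x \<bullet> w + d) has_derivative (\<lambda>v. v \<bullet> w)) (at x)"
      by (auto intro!: derivative_eq_intros)
    from has_derivative_compose[OF this flat_has_derivative[unfolded has_field_derivative_def]]
    show ?thesis by (simp add: algebra_simps)
  qed
  moreover have "flat_algebra (?D v)" for v
    by (intro flat_algebra.intros)
  ultimately show ?case by (intro exI[of _ ?D] conjI allI)
next
  case (add f g)
  then obtain F G where
    "\<And>x. (f has_derivative (\<lambda>v. F v x)) (at x)" "\<And>v. flat_algebra (F v)"
    "\<And>x. (g has_derivative (\<lambda>v. G v x)) (at x)" "\<And>v. flat_algebra (G v)" by blast
  then show ?case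
    by (intro exI[of _ "\<lambda>v x. F v x + G v x"]) (auto intro: flat_algebra.add has_derivative_add)
next
  case (mult f g)
  then obtain F G where
    "\<And>x. (f has_derivative (\<lambda>v. F v x)) (at x)" "\<And>v. flat_algebra (F v)"
    "\<And>x. (g has_derivative (\<lambda>v. G v x)) (at x)" "\<And>v. flat_algebra (G v)" by blast
  with mult.hyps show ?case
    by (intro exI[of _ "\<lambda>v x. f x * G v x + F v x * g x"])
       (auto intro!: flat_algebra.add flat_algebra.mult has_derivative_mult)
qed

lemma flat_algebra_Ck: "flat_algebra f \<Longrightarrow> Ck_on k UNIV f"
proof (induction k arbitrary: f)
  case 0
  then obtain D where "\<And>x. (f has_derivative (\<lambda>v. D v x)) (at x)"
    using flat_algebra_has_derivative by blast
  then show ?case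
    by (auto intro!: continuous_at_imp_continuous_on has_derivative_continuous)
next
  case (Suc k)
  then obtain D where D: "\<And>x. (f has_derivative (\<lambda>v. D v x)) (at x)" "\<And>v. flat_algebra (D v)"
    using flat_algebra_has_derivative by blast
  have "frechet_derivative f (at x) v = D v x" for x v
    using frechet_derivative_at[OF D(1), of x] by (metis (no_types))
  then show ?case
    using D Suc.IH by (auto simp: differentiable_def)
qed

text \<open>
  As \<open>k\<close> grows, every factor tends to \<open>1\<close> inside the box, while the product remains \<open>0\<close> outside.
\<close>
definition box_bump :: "real \<Rightarrow> 'a::euclidean_space \<Rightarrow> 'a \<Rightarrow> 'a \<Rightarrow> real" where
  "box_bump k a b x = (\<Prod>i\<in>Basis. flat 0 (k * (x \<bullet> i - a \<bullet> i)) * flat 0 (k * (b \<bullet> i - x \<bullet> i)))"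

lemma flat_algebra_prod:
  "finite I \<Longrightarrow> (\<And>i. i \<in> I \<Longrightarrow> flat_algebra (f i)) \<Longrightarrow> flat_algebra (\<lambda>x. \<Prod>i\<in>I. f i x)"
  by (induction rule: finite_induct) (auto intro: flat_algebra.intros)

lemma flat_algebra_box_bump: "flat_algebra (box_bump k a b)"
proof -
  have "flat_algebra (\<lambda>x. flat 0 (k * (x \<bullet> i - a \<bullet> i)) * flat 0 (k * (b \<bullet> i - x \<bullet> i)))" for i
    using flat_algebra.mult[OF flat_algebra.flat[of 0 "k *\<^sub>R i" "- k * (a \<bullet> i)"]
        flat_algebra.flat[of 0 "(- k) *\<^sub>R i" "k * (b \<bullet> i)"]]
    by (simp add: algebra_simps)
  then show ?thesis
    unfolding box_bump_def by (intro flat_algebra_prod) auto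
qed

lemma flat_0_bounds: "0 \<le> flat 0 t" "flat 0 t \<le> 1"
  by (auto simp: flat_def)

lemma box_bump_bounds: "0 \<le> box_bump k a b x" "box_bump k a b x \<le> 1"
  unfolding box_bump_def
  by (auto intro!: prod_nonneg prod_le_1 mult_le_one flat_0_bounds mult_nonneg_nonneg)

lemma box_bump_eq_0:
  assumes "0 \<le> k" "x \<notin> box a b"
  shows "box_bump k a b x = 0"
proof -
  from assms(2) obtain i where i: "i \<in> Basis" "x \<bullet> i \<le> a \<bullet> i \<or> b \<bullet> i \<le> x \<bullet> i"
    by (auto simp: mem_box not_less)
  have "flat 0 (k * (x \<bullet> i - a \<bullet> i)) * flat 0 (k * (b \<bullet> i - x \<bullet> i)) = 0"
    using i(2)
  proof
    assume "x \<bullet> i \<le> a \<bullet> i"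
    then have "k * (x \<bullet> i - a \<bullet> i) \<le> 0" using assms(1) by (simp add: mult_nonneg_nonpos)
    then show ?thesis by (simp add: flat_def)
  next
    assume "b \<bullet> i \<le> x \<bullet> i"
    then have "k * (b \<bullet> i - x \<bullet> i) \<le> 0" using assms(1) by (simp add: mult_nonneg_nonpos)
    then show ?thesis by (simp add: flat_def)
  qed
  then show ?thesis
    unfolding box_bump_def using i(1) by (auto intro!: prod_zero)
qed

lemma box_bump_tendsto_indicator:
  "(\<lambda>n. box_bump (real n) a b x) \<longlonglongrightarrow> indicator (box a b) x"
proof (cases "x \<in> box a b")
  case False
  then show ?thesis by (simp add: box_bump_eq_0)
next
  case True
  have lim: "(\<lambda>n. flat 0 (real n * s)) \<longlonglongrightarrow> 1" if "0 < s" for s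
  proof -
    have "(\<lambda>n. exp (- (1 / s) * (1 / real n))) \<longlonglongrightarrow> exp (- (1 / s) * 0)"
      by (intro tendsto_intros lim_1_over_n)
    then have "(\<lambda>n. exp (- (1 / s) * (1 / real n))) \<longlonglongrightarrow> 1" by simp
    then show ?thesis
    proof (rule Lim_transform_eventually)
      show "\<forall>\<^sub>F n in sequentially. exp (- (1 / s) * (1 / real n)) = flat 0 (real n * s)"
        using eventually_gt_at_top[of 0] by eventually_elim (use that in \<open>simp add: flat_def\<close>)
    qed
  qed
  have "(\<lambda>n. box_bump (real n) a b x) \<longlonglongrightarrow> (\<Prod>i\<in>(Basis :: 'a set). 1 * 1)"
    unfolding box_bump_def using True
    by (intro tendsto_prod tendsto_mult lim) (auto simp: mem_box)
  then show ?thesis using True by simp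
qed

lemma test_function_box_bump:
  assumes "cbox a b \<subseteq> \<Omega>" "0 \<le> k"
  shows "test_function \<Omega> (box_bump k a b)"
proof -
  have "box_bump k a b x = 0" if "x \<notin> cbox a b" for x
    using that box_subset_cbox[of a b] by (intro box_bump_eq_0[OF assms(2)]) blast
  then show ?thesis
    unfolding test_function_def
    using assms(1) by (auto intro!: flat_algebra_Ck flat_algebra_box_bump exI[of _ "cbox a b"])
qed

section \<open>Uniqueness and linearity of weak gradients\<close>

lemma locally_integrable_mult_compact_support:
  fixes f \<psi> :: "'a::euclidean_space \<Rightarrow> real"
  assumes f: "locally_integrable_on \<Omega> f" and \<psi>: "continuous_on UNIV \<psi>"
    and K: "compact K" "K \<subseteq> \<Omega>" "\<And>x. x \<notin> K \<Longrightarrow> \<psi> x = 0"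
  shows "set_integrable lebesgue \<Omega> (\<lambda>x. f x * \<psi> x)"
proof -
  have "set_integrable lebesgue K f"
    using f K by (simp add: locally_integrable_on_def)
  moreover have "K \<in> sets lebesgue" using K(1) by (simp add: compact_imp_closed)
  moreover have "\<psi> \<in> borel_measurable (lebesgue_on K)"
    using \<psi> \<open>K \<in> sets lebesgue\<close> by (intro continuous_imp_measurable_on_sets_lebesgue) (auto intro: continuous_on_subset)
  moreover have "bounded (\<psi> ` K)"
    using \<psi> K(1) by (intro compact_imp_bounded compact_continuous_image) (auto intro: continuous_on_subset)
  ultimately have "set_integrable lebesgue K (\<lambda>x. \<psi> x * f x)"
    by (intro absolutely_integrable_bounded_measurable_product[OF bilinear_times])
  moreover have "(\<lambda>x. indicator K x *\<^sub>R (\<psi> x * f x)) = (\<lambda>x. indicator \<Omega> x *\<^sub>R (f x * \<psi> x))"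
    using K by (auto simp: indicator_def fun_eq_iff)
  ultimately show ?thesis
    by (simp only: set_integrable_def)
qed

text \<open>
  The bumps of the box are test functions bounded by \<open>1\<close> which converge to its indicator, so
  dominated convergence applies.
\<close>
lemma set_integral_box_eq_0:
  fixes g :: "'a::euclidean_space \<Rightarrow> real"
  assumes g: "locally_integrable_on \<Omega> g"
    and zero: "\<And>\<phi>. test_function \<Omega> \<phi> \<Longrightarrow> (LINT x:\<Omega>|lebesgue. g x * \<phi> x) = 0"
    and sub: "cbox a b \<subseteq> \<Omega>"
  shows "(LINT x:box a b|lebesgue. g x) = 0"
proof -
  have int: "set_integrable lebesgue (cbox a b) g"
    using g sub by (simp add: locally_integrable_on_def)
  then have intb: "set_integrable lebesgue (box a b) g"
    by (rule set_integrable_subset) (auto simp: box_subset_cbox)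
  let ?s = "\<lambda>n x. (indicator (box a b) x *\<^sub>R g x) * box_bump (real n) a b x"
  have bump: "box_bump (real n) a b \<in> borel_measurable lebesgue" for n
    using flat_algebra_Ck[OF flat_algebra_box_bump, of 0 "real n" a b]
    by (intro measurable_completion) (simp add: borel_measurable_continuous_onI)
  have "(\<lambda>n. integral\<^sup>L lebesgue (?s n)) \<longlonglongrightarrow> integral\<^sup>L lebesgue (\<lambda>x. indicator (box a b) x *\<^sub>R g x)"
  proof (rule integral_dominated_convergence)
    show "integrable lebesgue (\<lambda>x. norm (indicator (box a b) x *\<^sub>R g x))"
      using intb unfolding set_integrable_def by (rule integrable_norm)
    show "(\<lambda>x. indicator (box a b) x *\<^sub>R g x) \<in> borel_measurable lebesgue"
      using intb unfolding set_integrable_def by (rule borel_measurable_integrable)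
    then show "?s n \<in> borel_measurable lebesgue" for n
      using bump by (intro borel_measurable_times)
    show "AE x in lebesgue. (\<lambda>n. ?s n x) \<longlonglongrightarrow> indicator (box a b) x *\<^sub>R g x"
    proof (intro AE_I2)
      fix x
      have "(\<lambda>n. ?s n x) \<longlonglongrightarrow> (indicator (box a b) x *\<^sub>R g x) * indicator (box a b) x"
        by (intro tendsto_intros box_bump_tendsto_indicator)
      then show "(\<lambda>n. ?s n x) \<longlonglongrightarrow> indicator (box a b) x *\<^sub>R g x"
        by (cases "x \<in> box a b") auto
    qed
    show "AE x in lebesgue. norm (?s n x) \<le> norm (indicator (box a b) x *\<^sub>R g x)" for n
      using box_bump_bounds[of "real n" a b]
      by (intro AE_I2) (simp add: abs_mult mult_left_le)
  qed
  moreover have "integral\<^sup>L lebesgue (?s n) = 0" for n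
  proof -
    have "(LINT x:\<Omega>|lebesgue. g x * box_bump (real n) a b x) = 0"
      using sub by (intro zero test_function_box_bump) auto
    moreover have "(\<lambda>x. indicator \<Omega> x *\<^sub>R (g x * box_bump (real n) a b x)) = ?s n"
      using sub box_subset_cbox[of a b] box_bump_eq_0[of "real n" _ a b]
      by (auto simp: indicator_def fun_eq_iff)
    ultimately show ?thesis by (simp only: set_lebesgue_integral_def)
  qed
  ultimately show ?thesis
    unfolding set_lebesgue_integral_def by (simp add: LIMSEQ_const_iff)
qed

text \<open>
  The fundamental lemma of the calculus of variations. Restricted to a closed box inside \<open>\<Omega>\<close>, the
  function has integral zero over every closed box, because two boxes meet in a box. Almost
  every value is the limit of averages over shrinking cubes, hence zero. Countably many closed boxes
  cover \<open>\<Omega>\<close>.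
\<close>
lemma locally_integrable_orthogonal_test_functions_eq_0:
  fixes g :: "'a::euclidean_space \<Rightarrow> real"
  assumes "open \<Omega>" and g: "locally_integrable_on \<Omega> g"
    and zero: "\<And>\<phi>. test_function \<Omega> \<phi> \<Longrightarrow> (LINT x:\<Omega>|lebesgue. g x * \<phi> x) = 0"
  shows "AE x in lebesgue. x \<in> \<Omega> \<longrightarrow> g x = 0"
proof -
  have box: "AE x in lebesgue. x \<in> cbox c d \<longrightarrow> g x = 0" if sub: "cbox c d \<subseteq> \<Omega>" for c d
  proof -
    let ?G = "\<lambda>x. if x \<in> cbox c d then g x else 0"
    have int: "set_integrable lebesgue (cbox a b) g" if "cbox a b \<subseteq> cbox c d" for a b
      using g sub that by (simp add: locally_integrable_on_def)
    have G: "?G integrable_on cbox a b \<and> integral (cbox a b) ?G = 0" for a b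
    proof -
      obtain a' b' where ab: "cbox a b \<inter> cbox c d = cbox a' b'"
        by (simp add: Int_interval)
      then have sub': "cbox a' b' \<subseteq> cbox c d" by auto
      then have *: "g integrable_on cbox a' b'"
        using int set_lebesgue_integral_eq_integral(1) by blast
      have "integral (cbox a' b') g = integral (box a' b') g"
        by (simp add: integral_open_interval)
      also have "\<dots> = (LINT x:box a' b'|lebesgue. g x)"
        using set_integrable_subset[OF int[OF sub'], of "box a' b'"] box_subset_cbox[of a' b']
        by (intro set_lebesgue_integral_eq_integral(2)[symmetric]) auto
      also have "\<dots> = 0"
        using sub sub' by (intro set_integral_box_eq_0[OF g zero]) auto
      finally have "(g has_integral 0) (cbox a' b')"
        using * by (simp add: has_integral_integral)
      then have "(?G has_integral 0) (cbox a b)"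
        using has_integral_restrict_Int[of "cbox c d" g 0 "cbox a b"] ab by (simp add: Int_commute)
      then show ?thesis by (simp add: has_integral_integrable_integral)
    qed
    obtain N where N: "negligible N" and lim: "\<And>x e. \<lbrakk>x \<notin> N; 0 < e\<rbrakk> \<Longrightarrow>
        \<exists>\<eta>>0. \<forall>h. 0 < h \<and> h < \<eta> \<longrightarrow>
          norm (integral (cbox x (x + h *\<^sub>R One)) ?G /\<^sub>R h ^ DIM('a) - ?G x) < e"
      using integrable_ccontinuous_explicit[of ?G] G by blast
    have "?G x = 0" if x: "x \<notin> N" for x
    proof (rule ccontr)
      assume "?G x \<noteq> 0"
      then obtain \<eta> where "0 < \<eta>" "\<And>h. 0 < h \<Longrightarrow> h < \<eta> \<Longrightarrow>
          norm (integral (cbox x (x + h *\<^sub>R One)) ?G /\<^sub>R h ^ DIM('a) - ?G x) < norm (?G x)"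
        using lim[OF x, of "norm (?G x)"] by auto
      from this(2)[of "\<eta> / 2"] this(1) show False by (simp add: G)
    qed
    moreover have "AE x in lebesgue. x \<notin> N"
      using N by (auto simp: negligible_iff_null_sets intro: AE_not_in)
    ultimately show ?thesis
      by (elim eventually_mono) meson
  qed
  obtain \<D> where \<D>: "countable \<D>" "\<D> \<subseteq> Pow \<Omega>" "\<And>X. X \<in> \<D> \<Longrightarrow> \<exists>a b. X = cbox a b" "\<Union>\<D> = \<Omega>"
    using open_countable_Union_open_cbox[OF \<open>open \<Omega>\<close>] by blast
  have "AE x in lebesgue. \<forall>X\<in>\<D>. x \<in> X \<longrightarrow> g x = 0"
    unfolding AE_ball_countable[OF \<D>(1)] using \<D>(2,3) box by blast
  then show ?thesis
    using \<D>(4) by (auto elim!: eventually_mono)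
qed

lemma test_function_integrable:
  fixes f \<phi> :: "'a::euclidean_space \<Rightarrow> real"
  assumes f: "locally_integrable_on \<Omega> f" and \<phi>: "test_function \<Omega> \<phi>"
  shows "set_integrable lebesgue \<Omega> (\<lambda>x. f x * \<phi> x)"
    and "set_integrable lebesgue \<Omega> (\<lambda>x. f x * frechet_derivative \<phi> (at x) v)"
proof -
  obtain K where K: "compact K" "K \<subseteq> \<Omega>" "\<And>x. x \<notin> K \<Longrightarrow> \<phi> x = 0"
    using \<phi> unfolding test_function_def by blast
  have Ck: "Ck_on k UNIV \<phi>" for k using \<phi> unfolding test_function_def by blast
  show "set_integrable lebesgue \<Omega> (\<lambda>x. f x * \<phi> x)"
    using Ck[of 0] by (intro locally_integrable_mult_compact_support[OF f _ K]) auto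
  show "set_integrable lebesgue \<Omega> (\<lambda>x. f x * frechet_derivative \<phi> (at x) v)"
  proof (rule locally_integrable_mult_compact_support[OF f _ K(1,2)])
    show "continuous_on UNIV (\<lambda>x. frechet_derivative \<phi> (at x) v)"
      using Ck[of "Suc 0"] by auto
    fix x assume "x \<notin> K"
    have "((\<lambda>_. 0) has_derivative (\<lambda>_. 0)) (at x)" by simp
    then have "(\<phi> has_derivative (\<lambda>_. 0)) (at x)"
      by (rule has_derivative_transform_within_open[of _ _ _ _ "- K"])
         (use \<open>x \<notin> K\<close> K in \<open>auto simp: compact_imp_closed\<close>)
    from frechet_derivative_at[OF this] show "frechet_derivative \<phi> (at x) v = 0"
      by (metis (no_types))
  qed
qed

lemma locally_integrable_inner:
  fixes g :: "'a::euclidean_space \<Rightarrow> 'a"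
  shows "locally_integrable_on \<Omega> g \<Longrightarrow> locally_integrable_on \<Omega> (\<lambda>x. g x \<bullet> b)"
  unfolding locally_integrable_on_def set_integrable_def
  using integrable_inner_left[of b lebesgue "\<lambda>x. indicator K x *\<^sub>R g x" for K] by simp

lemma locally_integrable_lincomb:
  fixes f g :: "'a::euclidean_space \<Rightarrow> 'b::euclidean_space"
  shows "locally_integrable_on \<Omega> f \<Longrightarrow> locally_integrable_on \<Omega> g \<Longrightarrow>
    locally_integrable_on \<Omega> (\<lambda>x. a *\<^sub>R f x + b *\<^sub>R g x)"
  unfolding locally_integrable_on_def
  by (auto intro!: set_integral_add set_integrable_scaleR_right)

lemma has_weak_gradient_lincomb:
  assumes u: "has_weak_gradient \<Omega> u g" and v: "has_weak_gradient \<Omega> v h"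
  shows "has_weak_gradient \<Omega> (\<lambda>x. a * u x + c * v x) (\<lambda>x. a *\<^sub>R g x + c *\<^sub>R h x)"
proof -
  have [measurable]: "g \<in> borel_measurable borel" "h \<in> borel_measurable borel"
    using u v by (auto simp: has_weak_gradient_def)
  have loc: "locally_integrable_on \<Omega> u" "locally_integrable_on \<Omega> g"
    "locally_integrable_on \<Omega> v" "locally_integrable_on \<Omega> h"
    using u v by (auto simp: has_weak_gradient_def)
  have "(LINT x:\<Omega>|lebesgue. (a * u x + c * v x) * frechet_derivative \<phi> (at x) b) =
      - (LINT x:\<Omega>|lebesgue. ((a *\<^sub>R g x + c *\<^sub>R h x) \<bullet> b) * \<phi> x)"
    if \<phi>: "test_function \<Omega> \<phi>" and b: "b \<in> Basis" for \<phi> b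
  proof -
    let ?d = "\<lambda>x. frechet_derivative \<phi> (at x) b"
    note int = test_function_integrable[OF loc(1) \<phi>] test_function_integrable[OF loc(3) \<phi>]
      test_function_integrable[OF locally_integrable_inner[OF loc(2)] \<phi>]
      test_function_integrable[OF locally_integrable_inner[OF loc(4)] \<phi>]
    have "(LINT x:\<Omega>|lebesgue. (a * u x + c * v x) * ?d x)
        = (LINT x:\<Omega>|lebesgue. a * (u x * ?d x) + c * (v x * ?d x))"
      by (simp add: algebra_simps)
    also have "\<dots> = a * (LINT x:\<Omega>|lebesgue. u x * ?d x) + c * (LINT x:\<Omega>|lebesgue. v x * ?d x)"
      using int by simp
    also have "\<dots> = - (a * (LINT x:\<Omega>|lebesgue. (g x \<bullet> b) * \<phi> x) + c * (LINT x:\<Omega>|lebesgue. (h x \<bullet> b) * \<phi> x))"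
      using u v \<phi> b by (simp add: has_weak_gradient_def)
    also have "a * (LINT x:\<Omega>|lebesgue. (g x \<bullet> b) * \<phi> x) + c * (LINT x:\<Omega>|lebesgue. (h x \<bullet> b) * \<phi> x)
        = (LINT x:\<Omega>|lebesgue. a * ((g x \<bullet> b) * \<phi> x) + c * ((h x \<bullet> b) * \<phi> x))"
      using int by simp
    also have "\<dots> = (LINT x:\<Omega>|lebesgue. ((a *\<^sub>R g x + c *\<^sub>R h x) \<bullet> b) * \<phi> x)"
      by (simp add: inner_add_left algebra_simps)
    finally show ?thesis .
  qed
  moreover have "locally_integrable_on \<Omega> (\<lambda>x. a * u x + c * v x)"
    using locally_integrable_lincomb[OF loc(1,3), of a c] by simp
  ultimately show ?thesis
    unfolding has_weak_gradient_def using locally_integrable_lincomb[OF loc(2,4)] by simp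
qed

text \<open>
  The difference of two weak gradients is a weak gradient of the zero function, so each of its
  components is orthogonal to all test functions.
\<close>
lemma has_weak_gradient_unique:
  assumes "open \<Omega>" and g: "has_weak_gradient \<Omega> u g" and h: "has_weak_gradient \<Omega> u h"
  shows "AE x in lebesgue. x \<in> \<Omega> \<longrightarrow> g x = h x"
proof -
  have diff: "has_weak_gradient \<Omega> (\<lambda>x. 0) (\<lambda>x. g x - h x)"
    using has_weak_gradient_lincomb[OF g h, of 1 "-1"] by simp
  have "AE x in lebesgue. x \<in> \<Omega> \<longrightarrow> (g x - h x) \<bullet> b = 0" if "b \<in> Basis" for b
  proof (rule locally_integrable_orthogonal_test_functions_eq_0[OF \<open>open \<Omega>\<close>])
    show "locally_integrable_on \<Omega> (\<lambda>x. (g x - h x) \<bullet> b)"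
      using diff by (intro locally_integrable_inner) (simp add: has_weak_gradient_def)
    show "(LINT x:\<Omega>|lebesgue. ((g x - h x) \<bullet> b) * \<phi> x) = 0" if "test_function \<Omega> \<phi>" for \<phi>
      using diff that \<open>b \<in> Basis\<close> by (simp add: has_weak_gradient_def set_lebesgue_integral_def)
  qed
  then have "AE x in lebesgue. \<forall>b\<in>Basis. x \<in> \<Omega> \<longrightarrow> (g x - h x) \<bullet> b = 0"
    by (subst AE_ball_countable) (auto intro: countable_finite)
  then show ?thesis
    by eventually_elim (auto simp: euclidean_eq_iff[where 'a='a] inner_diff_left)
qed

lemma has_weak_gradient_cong_AE:
  assumes u: "has_weak_gradient \<Omega> u g" and \<Omega>: "\<Omega> \<in> sets lebesgue"
    and meas: "u \<in> borel_measurable borel" "v \<in> borel_measurable borel"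
    and eq: "AE x in lebesgue. u x = v x"
  shows "has_weak_gradient \<Omega> v g"
proof -
  have [measurable]: "u \<in> borel_measurable lebesgue" "v \<in> borel_measurable lebesgue"
    using meas by (auto intro: measurable_completion)
  have "set_integrable lebesgue K u = set_integrable lebesgue K v" if "compact K" for K
    using that eq by (intro set_integrable_cong_AE) (auto simp: compact_imp_closed)
  moreover have "(LINT x:\<Omega>|lebesgue. u x * frechet_derivative \<phi> (at x) b)
      = (LINT x:\<Omega>|lebesgue. v x * frechet_derivative \<phi> (at x) b)" if "test_function \<Omega> \<phi>" for \<phi> b
  proof -
    have "continuous_on UNIV (\<lambda>x. frechet_derivative \<phi> (at x) b)"
      using that Ck_on.simps(2)[of 0 UNIV \<phi>] unfolding test_function_def by (metis Ck_on.simps(1))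
    then have [measurable]: "(\<lambda>x. frechet_derivative \<phi> (at x) b) \<in> borel_measurable lebesgue"
      by (intro measurable_completion) (simp add: borel_measurable_continuous_onI)
    show ?thesis
      using eq \<Omega> by (intro set_lebesgue_integral_cong_AE) (auto elim!: eventually_mono)
  qed
  ultimately show ?thesis
    using u unfolding has_weak_gradient_def locally_integrable_on_def by simp
qed

section \<open>The modular of the Sobolev space\<close>

lemma rep_ae_fun_measurable: "rep_ae_fun u \<in> borel_measurable borel"
  using Quotient3_rep_reflp[OF Quotient3_ae_fun, of u] by simp

lemma abs_rep_ae_fun: "abs_ae_fun (rep_ae_fun u) = u"
  using Quotient3_abs_rep[OF Quotient3_ae_fun] .

lemma rep_abs_ae_fun:
  assumes "f \<in> borel_measurable borel"
  shows "AE x in lebesgue. rep_ae_fun (abs_ae_fun f) x = f x"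
  using rep_abs_rsp_left[OF Quotient3_ae_fun, of f f] assms by simp

lemma ae_fun_eq_iff: "u = v \<longleftrightarrow> (AE x in lebesgue. rep_ae_fun u x = rep_ae_fun v x)"
  using Quotient3_rel_rep[OF Quotient3_ae_fun, of u v] rep_ae_fun_measurable[of u] rep_ae_fun_measurable[of v]
  by simp

lemma rep_ae_fun_lincomb:
  "AE x in lebesgue. rep_ae_fun (a *\<^sub>R u + c *\<^sub>R v) x = a * rep_ae_fun u x + c * rep_ae_fun v x"
proof -
  have "a *\<^sub>R u + c *\<^sub>R v = abs_ae_fun (\<lambda>x. a * rep_ae_fun u x + c * rep_ae_fun v x)"
    using rep_ae_fun_measurable[of u] rep_ae_fun_measurable[of v]
    by (subst abs_rep_ae_fun[of u, symmetric], subst abs_rep_ae_fun[of v, symmetric])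
       (simp add: scaleR_ae_fun.abs_eq plus_ae_fun.abs_eq)
  moreover have "AE x in lebesgue. rep_ae_fun (abs_ae_fun (\<lambda>x. a * rep_ae_fun u x + c * rep_ae_fun v x)) x
      = a * rep_ae_fun u x + c * rep_ae_fun v x"
    using rep_ae_fun_measurable[of u] rep_ae_fun_measurable[of v]
    by (intro rep_abs_ae_fun borel_measurable_add borel_measurable_times) auto
  ultimately show ?thesis by simp
qed

lemma rep_ae_fun_0: "AE x in lebesgue. rep_ae_fun 0 x = 0"
  using rep_ae_fun_lincomb[of 0 0 0 0] by simp

lemma has_weak_gradient_weak_gradient:
  "\<exists>g. has_weak_gradient \<Omega> (rep_ae_fun u) g \<Longrightarrow> has_weak_gradient \<Omega> (rep_ae_fun u) (weak_gradient \<Omega> u)"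
  unfolding weak_gradient_def by (rule someI_ex[of "has_weak_gradient \<Omega> (rep_ae_fun u)"])

text \<open>
  Both sides are weak gradients of the same function; the representatives on the two sides agree
  only almost everywhere, which a weak gradient does not notice.
\<close>
lemma weak_gradient_lincomb:
  fixes u v :: "'a::euclidean_space ae_fun"
  assumes \<Omega>: "open \<Omega>" and u: "\<exists>g. has_weak_gradient \<Omega> (rep_ae_fun u) g"
    and v: "\<exists>g. has_weak_gradient \<Omega> (rep_ae_fun v) g"
  shows "\<exists>g. has_weak_gradient \<Omega> (rep_ae_fun (a *\<^sub>R u + c *\<^sub>R v)) g"
    and "AE x in lebesgue. x \<in> \<Omega> \<longrightarrow>
      weak_gradient \<Omega> (a *\<^sub>R u + c *\<^sub>R v) x = a *\<^sub>R weak_gradient \<Omega> u x + c *\<^sub>R weak_gradient \<Omega> v x"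
proof -
  note [measurable] = rep_ae_fun_measurable
  have grad: "has_weak_gradient \<Omega> (rep_ae_fun (a *\<^sub>R u + c *\<^sub>R v))
      (\<lambda>x. a *\<^sub>R weak_gradient \<Omega> u x + c *\<^sub>R weak_gradient \<Omega> v x)"
  proof (rule has_weak_gradient_cong_AE)
    show "has_weak_gradient \<Omega> (\<lambda>x. a * rep_ae_fun u x + c * rep_ae_fun v x)
        (\<lambda>x. a *\<^sub>R weak_gradient \<Omega> u x + c *\<^sub>R weak_gradient \<Omega> v x)"
      using u v by (intro has_weak_gradient_lincomb has_weak_gradient_weak_gradient)
    show "\<Omega> \<in> sets lebesgue" using \<Omega> by simp
    show "AE x in lebesgue. a * rep_ae_fun u x + c * rep_ae_fun v x = rep_ae_fun (a *\<^sub>R u + c *\<^sub>R v) x"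
      using rep_ae_fun_lincomb[of a u c v] by (auto elim: eventually_mono)
  qed measurable
  then show ex: "\<exists>g. has_weak_gradient \<Omega> (rep_ae_fun (a *\<^sub>R u + c *\<^sub>R v)) g" by blast
  show "AE x in lebesgue. x \<in> \<Omega> \<longrightarrow>
      weak_gradient \<Omega> (a *\<^sub>R u + c *\<^sub>R v) x = a *\<^sub>R weak_gradient \<Omega> u x + c *\<^sub>R weak_gradient \<Omega> v x"
    by (rule has_weak_gradient_unique[OF \<Omega> has_weak_gradient_weak_gradient[OF ex] grad])
qed

lemma weakly_differentiable_0:
  "\<exists>g. has_weak_gradient \<Omega> (rep_ae_fun (0 :: 'a::euclidean_space ae_fun)) g" if "open \<Omega>"
proof -
  have "has_weak_gradient \<Omega> (rep_ae_fun (0 :: 'a ae_fun)) (\<lambda>_. 0)"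
  proof (rule has_weak_gradient_cong_AE)
    show "has_weak_gradient \<Omega> (\<lambda>_. 0) (\<lambda>_. 0 :: 'a)"
      by (simp add: has_weak_gradient_def locally_integrable_on_def set_integrable_def)
    show "AE x in lebesgue. 0 = rep_ae_fun (0 :: 'a ae_fun) x"
      using rep_ae_fun_0 by (auto elim: eventually_mono)
  qed (use that rep_ae_fun_measurable in auto)
  then show ?thesis by blast
qed

text \<open>
  The common pattern behind convexity, homogeneity and uniform convexity of the modular: a
  two-variable inequality between powers of norms of two linear combinations, valid for all
  exponents \<open>r \<ge> q\<close>, is inherited by the modular. The identities for \<open>W\<close> and \<open>Z\<close> are required almost
  everywhere only, as they hold for weak gradients.
\<close>
lemma rho_p_norm_inequality:
  fixes F G W Z :: "'a::euclidean_space \<Rightarrow> 'b::{real_normed_vector, second_countable_topology}"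
  assumes \<Omega>: "\<Omega> \<in> sets lebesgue" and p: "p \<in> borel_measurable (lebesgue_on \<Omega>)"
    and q: "0 < q" "\<And>x. x \<in> \<Omega> \<Longrightarrow> q \<le> p x"
    and meas: "F \<in> borel_measurable borel" "G \<in> borel_measurable borel"
      "W \<in> borel_measurable borel" "Z \<in> borel_measurable borel"
    and W: "AE x in lebesgue. x \<in> \<Omega> \<longrightarrow> W x = a1 *\<^sub>R F x + c1 *\<^sub>R G x"
    and Z: "AE x in lebesgue. x \<in> \<Omega> \<longrightarrow> Z x = a2 *\<^sub>R F x + c2 *\<^sub>R G x"
    and coeff: "0 \<le> s" "0 \<le> t" "0 \<le> k" "0 \<le> l"
    and ineq: "\<And>r (x::'b) y. q \<le> r \<Longrightarrow>
      s * norm (a1 *\<^sub>R x + c1 *\<^sub>R y) powr r + t * norm (a2 *\<^sub>R x + c2 *\<^sub>R y) powr r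
      \<le> k * norm x powr r + l * norm y powr r"
  shows "ennreal s * rho_p \<Omega> p (\<lambda>x. norm (W x)) + ennreal t * rho_p \<Omega> p (\<lambda>x. norm (Z x))
    \<le> ennreal k * rho_p \<Omega> p (\<lambda>x. norm (F x)) + ennreal l * rho_p \<Omega> p (\<lambda>x. norm (G x))"
proof (rule rho_p_linear_mono[OF \<Omega> p])
  show "0 < p x" if "x \<in> \<Omega>" for x using q that by force
  show "AE x in lebesgue. x \<in> \<Omega> \<longrightarrow>
      s * \<bar>norm (W x)\<bar> powr p x + t * \<bar>norm (Z x)\<bar> powr p x
      \<le> k * \<bar>norm (F x)\<bar> powr p x + l * \<bar>norm (G x)\<bar> powr p x"
    using W Z by eventually_elim (use ineq q in auto)
qed (use meas coeff in \<open>auto intro: borel_measurable_norm\<close>)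

text \<open>
  The pointwise inequality is needed twice: on real numbers for the functions and on the Euclidean
  space for the gradients.
\<close>
lemma rho_1p_inequality:
  fixes u v :: "'a::euclidean_space ae_fun"
  assumes \<Omega>: "open \<Omega>" and p: "p \<in> borel_measurable (lebesgue_on \<Omega>)"
    and q: "0 < q" "\<And>x. x \<in> \<Omega> \<Longrightarrow> q \<le> p x"
    and u: "\<exists>g. has_weak_gradient \<Omega> (rep_ae_fun u) g"
    and v: "\<exists>g. has_weak_gradient \<Omega> (rep_ae_fun v) g"
    and coeff: "0 \<le> s" "0 \<le> t" "0 \<le> k" "0 \<le> l"
    and ineq_real: "\<And>r (x::real) y. q \<le> r \<Longrightarrow>
      s * norm (a1 *\<^sub>R x + c1 *\<^sub>R y) powr r + t * norm (a2 *\<^sub>R x + c2 *\<^sub>R y) powr r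
      \<le> k * norm x powr r + l * norm y powr r"
    and ineq: "\<And>r (x::'a) y. q \<le> r \<Longrightarrow>
      s * norm (a1 *\<^sub>R x + c1 *\<^sub>R y) powr r + t * norm (a2 *\<^sub>R x + c2 *\<^sub>R y) powr r
      \<le> k * norm x powr r + l * norm y powr r"
  shows "ennreal s * rho_1p \<Omega> p (a1 *\<^sub>R u + c1 *\<^sub>R v) + ennreal t * rho_1p \<Omega> p (a2 *\<^sub>R u + c2 *\<^sub>R v)
    \<le> ennreal k * rho_1p \<Omega> p u + ennreal l * rho_1p \<Omega> p v"
proof -
  have sets: "\<Omega> \<in> sets lebesgue" using \<Omega> by simp
  have abs: "rho_p \<Omega> p f = rho_p \<Omega> p (\<lambda>x. norm (f x))" for f :: "'a \<Rightarrow> real"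
    by (simp add: rho_p_def)
  have grad: "weak_gradient \<Omega> w \<in> borel_measurable borel"
    if "\<exists>g. has_weak_gradient \<Omega> (rep_ae_fun w) g" for w :: "'a ae_fun"
    using has_weak_gradient_weak_gradient[OF that] by (simp add: has_weak_gradient_def)
  let ?w = "a1 *\<^sub>R u + c1 *\<^sub>R v" and ?z = "a2 *\<^sub>R u + c2 *\<^sub>R v"
  have fun_part: "ennreal s * rho_p \<Omega> p (rep_ae_fun ?w) + ennreal t * rho_p \<Omega> p (rep_ae_fun ?z)
      \<le> ennreal k * rho_p \<Omega> p (rep_ae_fun u) + ennreal l * rho_p \<Omega> p (rep_ae_fun v)"
    unfolding abs[of "rep_ae_fun _"]
    using rep_ae_fun_lincomb[of a1 u c1 v] rep_ae_fun_lincomb[of a2 u c2 v]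
    by (intro rho_p_norm_inequality[OF sets p q rep_ae_fun_measurable rep_ae_fun_measurable
          rep_ae_fun_measurable rep_ae_fun_measurable _ _ coeff ineq_real])
       (auto elim: eventually_mono)
  have grad_part: "ennreal s * rho_p \<Omega> p (\<lambda>x. norm (weak_gradient \<Omega> ?w x))
        + ennreal t * rho_p \<Omega> p (\<lambda>x. norm (weak_gradient \<Omega> ?z x))
      \<le> ennreal k * rho_p \<Omega> p (\<lambda>x. norm (weak_gradient \<Omega> u x))
        + ennreal l * rho_p \<Omega> p (\<lambda>x. norm (weak_gradient \<Omega> v x))"
    by (rule rho_p_norm_inequality[OF sets p q grad[OF u] grad[OF v]
          grad[OF weak_gradient_lincomb(1)[OF \<Omega> u v]] grad[OF weak_gradient_lincomb(1)[OF \<Omega> u v]]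
          weak_gradient_lincomb(2)[OF \<Omega> u v] weak_gradient_lincomb(2)[OF \<Omega> u v] coeff ineq])
  from add_mono[OF fun_part grad_part] show ?thesis
    by (simp only: rho_1p_def distrib_left add_ac)
qed

lemma rho_1p_convex:
  fixes u v :: "'a::euclidean_space ae_fun"
  assumes \<Omega>: "open \<Omega>" and p: "p \<in> borel_measurable (lebesgue_on \<Omega>)"
    and q: "1 \<le> q" "\<And>x. x \<in> \<Omega> \<Longrightarrow> q \<le> p x"
    and u: "\<exists>g. has_weak_gradient \<Omega> (rep_ae_fun u) g"
    and v: "\<exists>g. has_weak_gradient \<Omega> (rep_ae_fun v) g"
    and \<alpha>: "0 \<le> \<alpha>" "\<alpha> \<le> 1"
  shows "rho_1p \<Omega> p (\<alpha> *\<^sub>R u + (1 - \<alpha>) *\<^sub>R v) \<le> ennreal \<alpha> * rho_1p \<Omega> p u + ennreal (1 - \<alpha>) * rho_1p \<Omega> p v"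
proof -
  have "ennreal 1 * rho_1p \<Omega> p (\<alpha> *\<^sub>R u + (1 - \<alpha>) *\<^sub>R v) + ennreal 0 * rho_1p \<Omega> p (0 *\<^sub>R u + 0 *\<^sub>R v)
      \<le> ennreal \<alpha> * rho_1p \<Omega> p u + ennreal (1 - \<alpha>) * rho_1p \<Omega> p v"
  proof (rule rho_1p_inequality[OF \<Omega> p _ q(2) u v])
    show "1 * norm (\<alpha> *\<^sub>R x + (1 - \<alpha>) *\<^sub>R y) powr r + 0 * norm (0 *\<^sub>R x + 0 *\<^sub>R y) powr r
        \<le> \<alpha> * norm x powr r + (1 - \<alpha>) * norm y powr r" if "q \<le> r" for r and x y :: real
      using norm_powr_convex[of r \<alpha> x y] that q \<alpha> by simp
    show "1 * norm (\<alpha> *\<^sub>R x + (1 - \<alpha>) *\<^sub>R y) powr r + 0 * norm (0 *\<^sub>R x + 0 *\<^sub>R y) powr r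
        \<le> \<alpha> * norm x powr r + (1 - \<alpha>) * norm y powr r" if "q \<le> r" for r and x y :: 'a
      using norm_powr_convex[of r \<alpha> x y] that q \<alpha> by simp
  qed (use q \<alpha> in auto)
  then show ?thesis by simp
qed

lemma norm_scaleR_powr_le:
  fixes x :: "'a::real_normed_vector"
  shows "0 \<le> r \<Longrightarrow> \<bar>c\<bar> \<le> 1 \<Longrightarrow> norm (c *\<^sub>R x) powr r \<le> norm x powr r"
  by (intro powr_mono2) (auto simp: mult_left_le_one_le)

lemma rho_1p_scaleR_le:
  fixes u :: "'a::euclidean_space ae_fun"
  assumes \<Omega>: "open \<Omega>" and p: "p \<in> borel_measurable (lebesgue_on \<Omega>)"
    and q: "0 < q" "\<And>x. x \<in> \<Omega> \<Longrightarrow> q \<le> p x"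
    and u: "\<exists>g. has_weak_gradient \<Omega> (rep_ae_fun u) g"
    and c: "\<bar>c\<bar> \<le> 1"
  shows "rho_1p \<Omega> p (c *\<^sub>R u) \<le> rho_1p \<Omega> p u"
proof -
  have "ennreal 1 * rho_1p \<Omega> p (c *\<^sub>R u + 0 *\<^sub>R u) + ennreal 0 * rho_1p \<Omega> p (0 *\<^sub>R u + 0 *\<^sub>R u)
      \<le> ennreal 1 * rho_1p \<Omega> p u + ennreal 0 * rho_1p \<Omega> p u"
  proof (rule rho_1p_inequality[OF \<Omega> p q u u])
    show "1 * norm (c *\<^sub>R x + 0 *\<^sub>R y) powr r + 0 * norm (0 *\<^sub>R x + 0 *\<^sub>R y) powr r
        \<le> 1 * norm x powr r + 0 * norm y powr r" if "q \<le> r" for r and x y :: real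
      using norm_scaleR_powr_le[of r c x] that q c by simp
    show "1 * norm (c *\<^sub>R x + 0 *\<^sub>R y) powr r + 0 * norm (0 *\<^sub>R x + 0 *\<^sub>R y) powr r
        \<le> 1 * norm x powr r + 0 * norm y powr r" if "q \<le> r" for r and x y :: 'a
      using norm_scaleR_powr_le[of r c x] that q c by simp
  qed auto
  then show ?thesis by simp
qed

lemma rho_1p_uniformly_convex:
  fixes u v :: "'a::euclidean_space ae_fun"
  assumes \<Omega>: "open \<Omega>" and p: "p \<in> borel_measurable (lebesgue_on \<Omega>)"
    and q: "1 < q" "\<And>x. x \<in> \<Omega> \<Longrightarrow> q \<le> p x"
    and u: "\<exists>g. has_weak_gradient \<Omega> (rep_ae_fun u) g"
    and v: "\<exists>g. has_weak_gradient \<Omega> (rep_ae_fun v) g"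
    and \<epsilon>: "0 < \<epsilon>"
  defines "\<delta> \<equiv> convexity_gain q \<epsilon>"
  shows "rho_1p \<Omega> p ((u + v) /\<^sub>R 2) + ennreal \<delta> * rho_1p \<Omega> p ((u - v) /\<^sub>R 2)
    \<le> ennreal (1 + \<delta> * \<epsilon>) * ((rho_1p \<Omega> p u + rho_1p \<Omega> p v) / 2)"
proof -
  have \<delta>: "0 < \<delta>" unfolding \<delta>_def by (rule convexity_gain_pos[OF q(1) \<epsilon>])
  let ?K = "(1 + \<delta> * \<epsilon>) / 2"
  have ineq: "1 * norm ((1 / 2) *\<^sub>R x + (1 / 2) *\<^sub>R y) powr r + \<delta> * norm ((1 / 2) *\<^sub>R x + (- 1 / 2) *\<^sub>R y) powr r
      \<le> ?K * norm x powr r + ?K * norm y powr r" if "q \<le> r" for r and x y :: "'b::real_inner"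
    using norm_powr_uniformly_convex[OF q(1) \<epsilon> that, of x y]
    by (simp add: \<delta>_def scaleR_add_right scaleR_diff_right field_simps)
  have "ennreal 1 * rho_1p \<Omega> p ((1 / 2) *\<^sub>R u + (1 / 2) *\<^sub>R v) + ennreal \<delta> * rho_1p \<Omega> p ((1 / 2) *\<^sub>R u + (- 1 / 2) *\<^sub>R v)
      \<le> ennreal ?K * rho_1p \<Omega> p u + ennreal ?K * rho_1p \<Omega> p v"
    by (rule rho_1p_inequality[OF \<Omega> p _ q(2) u v _ _ _ _ ineq ineq]) (use q \<delta> \<epsilon> in auto)
  also have "\<dots> = ennreal (1 + \<delta> * \<epsilon>) * ((rho_1p \<Omega> p u + rho_1p \<Omega> p v) / 2)"
  proof -
    have "ennreal ?K = ennreal (1 + \<delta> * \<epsilon>) * ennreal (1 / 2)"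
      by (subst ennreal_mult[symmetric]) (use \<delta> \<epsilon> in auto)
    then show ?thesis
      by (simp only: ennreal_half distrib_left[symmetric] mult.assoc)
  qed
  finally show ?thesis
    by (simp add: scaleR_add_right scaleR_diff_right)
qed

text \<open>
  The function term alone forces \<open>u\<close> to vanish almost everywhere in \<open>\<Omega>\<close>; outside \<open>\<Omega>\<close> it vanishes
  by assumption. Conversely, the gradient of zero is zero almost everywhere by linearity.
\<close>
lemma rho_1p_eq_0_iff:
  fixes u :: "'a::euclidean_space ae_fun"
  assumes \<Omega>: "open \<Omega>" and p: "p \<in> borel_measurable (lebesgue_on \<Omega>)"
    and q: "0 < q" "\<And>x. x \<in> \<Omega> \<Longrightarrow> q \<le> p x"
    and u: "\<exists>g. has_weak_gradient \<Omega> (rep_ae_fun u) g"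
    and outside: "AE x in lebesgue. x \<notin> \<Omega> \<longrightarrow> rep_ae_fun u x = 0"
  shows "rho_1p \<Omega> p u = 0 \<longleftrightarrow> u = 0"
proof
  have sets: "\<Omega> \<in> sets lebesgue" using \<Omega> by simp
  have pos: "0 < p x" if "x \<in> \<Omega>" for x using q that by force
  note zero_iff = rho_p_eq_0_iff[OF sets p pos]
  {
    assume "rho_1p \<Omega> p u = 0"
    then have "rho_p \<Omega> p (rep_ae_fun u) = 0" by (simp add: rho_1p_def)
    then have "AE x in lebesgue. x \<in> \<Omega> \<longrightarrow> rep_ae_fun u x = 0"
      by (simp add: zero_iff rep_ae_fun_measurable)
    then have "AE x in lebesgue. rep_ae_fun u x = rep_ae_fun 0 x"
      using outside rep_ae_fun_0 by eventually_elim auto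
    then show "u = 0" by (simp add: ae_fun_eq_iff)
  next
    assume u0: "u = 0"
    have "AE x in lebesgue. x \<in> \<Omega> \<longrightarrow> weak_gradient \<Omega> u x = 0"
      using weak_gradient_lincomb(2)[OF \<Omega> u u, of 0 0] by (simp add: u0)
    moreover have "(\<lambda>x. norm (weak_gradient \<Omega> u x)) \<in> borel_measurable borel"
      using has_weak_gradient_weak_gradient[OF u] by (auto simp: has_weak_gradient_def intro: borel_measurable_norm)
    moreover have "AE x in lebesgue. x \<in> \<Omega> \<longrightarrow> rep_ae_fun u x = 0"
      using rep_ae_fun_0 by (auto simp: u0 elim: eventually_mono)
    ultimately show "rho_1p \<Omega> p u = 0"
      by (simp add: rho_1p_def zero_iff rep_ae_fun_measurable)
  }
qed

text \<open>
  Only some multiple of each function has finite modular, with a factor that depends on the function.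
  A sum is scaled so far down that convexity bounds its modular by those two finite values.
\<close>
lemma subspace_W_1p:
  fixes \<Omega> :: "'a::euclidean_space set"
  assumes \<Omega>: "open \<Omega>" and p: "p \<in> borel_measurable (lebesgue_on \<Omega>)"
    and q: "1 \<le> q" "\<And>x. x \<in> \<Omega> \<Longrightarrow> q \<le> p x"
  shows "subspace (W_1p \<Omega> p)"
proof -
  have q0: "0 < q" using q by simp
  note diff_lincomb = weak_gradient_lincomb(1)[OF \<Omega>]
  note scale_le = rho_1p_scaleR_le[OF \<Omega> p q0 q(2)]
  have diff_scale: "\<exists>g. has_weak_gradient \<Omega> (rep_ae_fun (c *\<^sub>R u)) g"
    if "\<exists>g. has_weak_gradient \<Omega> (rep_ae_fun u) g" for c u
    using diff_lincomb[OF that that, of c 0] by simp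
  have lincomb: "a *\<^sub>R u + b *\<^sub>R v \<in> W_1p \<Omega> p" if u: "u \<in> W_1p \<Omega> p" and v: "v \<in> W_1p \<Omega> p" for a b u v
  proof -
    from u obtain c where c: "c > 0" "rho_1p \<Omega> p (c *\<^sub>R u) < \<infinity>" and
      diff_u: "\<exists>g. has_weak_gradient \<Omega> (rep_ae_fun u) g" and
      out_u: "AE x in lebesgue. x \<notin> \<Omega> \<longrightarrow> rep_ae_fun u x = 0"
      by (auto simp: W_1p_def)
    from v obtain d where d: "d > 0" "rho_1p \<Omega> p (d *\<^sub>R v) < \<infinity>" and
      diff_v: "\<exists>g. has_weak_gradient \<Omega> (rep_ae_fun v) g" and
      out_v: "AE x in lebesgue. x \<notin> \<Omega> \<longrightarrow> rep_ae_fun v x = 0"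
      by (auto simp: W_1p_def)
    (* The scale e is chosen so that e (a u + b v) is the midpoint of multiples of c u and d v with
       factors of modulus at most 1. *)
    define M where "M = \<bar>a\<bar> / c + \<bar>b\<bar> / d + 1"
    have M: "0 < M" "\<bar>a / c\<bar> \<le> M" "\<bar>b / d\<bar> \<le> M"
      using c d by (auto simp: M_def add_nonneg_pos)
    define e where "e = 1 / (2 * M)"
    have e: "0 < e" using M by (simp add: e_def)
    have small: "\<bar>2 * e * a / c\<bar> \<le> 1" "\<bar>2 * e * b / d\<bar> \<le> 1"
    proof -
      have "\<bar>2 * e * a / c\<bar> = \<bar>a / c\<bar> / M" "\<bar>2 * e * b / d\<bar> = \<bar>b / d\<bar> / M"
        using M(1) by (simp_all add: e_def abs_mult)
      then show "\<bar>2 * e * a / c\<bar> \<le> 1" "\<bar>2 * e * b / d\<bar> \<le> 1"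
        using M by (simp_all only: divide_le_eq_1_pos)
    qed
    have "e *\<^sub>R (a *\<^sub>R u + b *\<^sub>R v)
        = (1 / 2) *\<^sub>R ((2 * e * a / c) *\<^sub>R (c *\<^sub>R u)) + (1 - 1 / 2) *\<^sub>R ((2 * e * b / d) *\<^sub>R (d *\<^sub>R v))"
      using c(1) d(1) by (simp add: scaleR_add_right)
    then have "rho_1p \<Omega> p (e *\<^sub>R (a *\<^sub>R u + b *\<^sub>R v))
        \<le> ennreal (1 / 2) * rho_1p \<Omega> p ((2 * e * a / c) *\<^sub>R (c *\<^sub>R u))
          + ennreal (1 - 1 / 2) * rho_1p \<Omega> p ((2 * e * b / d) *\<^sub>R (d *\<^sub>R v))"
      by (simp only:) (intro rho_1p_convex[OF \<Omega> p q] diff_scale diff_u diff_v; simp)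
    also have "\<dots> \<le> ennreal (1 / 2) * rho_1p \<Omega> p (c *\<^sub>R u) + ennreal (1 - 1 / 2) * rho_1p \<Omega> p (d *\<^sub>R v)"
      by (intro add_mono mult_left_mono scale_le diff_scale diff_u diff_v small) auto
    also have "\<dots> < \<infinity>"
      unfolding infinity_ennreal_def ennreal_add_less_top
      using c(2) d(2) by (intro conjI ennreal_mult_less_top[THEN iffD2] disjI2 ennreal_less_top) auto
    finally have "rho_1p \<Omega> p (e *\<^sub>R (a *\<^sub>R u + b *\<^sub>R v)) < \<infinity>" .
    moreover have "AE x in lebesgue. x \<notin> \<Omega> \<longrightarrow> rep_ae_fun (a *\<^sub>R u + b *\<^sub>R v) x = 0"
      using rep_ae_fun_lincomb[of a u b v] out_u out_v by eventually_elim auto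
    ultimately show ?thesis
      using e diff_lincomb[OF diff_u diff_v] unfolding W_1p_def by blast
  qed
  show ?thesis
  proof (rule subspaceI)
    have diff_0: "\<exists>g. has_weak_gradient \<Omega> (rep_ae_fun 0) g"
      by (rule weakly_differentiable_0[OF \<Omega>])
    have out_0: "AE x in lebesgue. x \<notin> \<Omega> \<longrightarrow> rep_ae_fun 0 x = 0"
      using rep_ae_fun_0 by (auto elim: eventually_mono)
    have "rho_1p \<Omega> p (1 *\<^sub>R 0) < \<infinity>"
      using rho_1p_eq_0_iff[OF \<Omega> p q0 q(2) diff_0 out_0] by simp
    with diff_0 out_0 show "0 \<in> W_1p \<Omega> p"
      unfolding W_1p_def using zero_less_one by blast
  next
    show "x + y \<in> W_1p \<Omega> p" if "x \<in> W_1p \<Omega> p" "y \<in> W_1p \<Omega> p" for x y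
      using lincomb[OF that, of 1 1] by simp
    show "c *\<^sub>R x \<in> W_1p \<Omega> p" if "x \<in> W_1p \<Omega> p" for c x
      using lincomb[OF that that, of c 0] by simp
  qed
qed

lemma convex_modular_rho_1p:
  fixes \<Omega> :: "'a::euclidean_space set"
  assumes \<Omega>: "open \<Omega>" and p: "p \<in> borel_measurable (lebesgue_on \<Omega>)"
    and q: "1 \<le> q" "\<And>x. x \<in> \<Omega> \<Longrightarrow> q \<le> p x"
  shows "convex_modular (W_1p \<Omega> p) (rho_1p \<Omega> p)"
proof -
  have q0: "0 < q" using q by simp
  have diff: "\<exists>g. has_weak_gradient \<Omega> (rep_ae_fun u) g" if "u \<in> W_1p \<Omega> p" for u
    using that by (simp add: W_1p_def)
  show ?thesis
    unfolding convex_modular_def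
  proof (intro conjI ballI allI impI)
    show sub: "subspace (W_1p \<Omega> p)" by (rule subspace_W_1p[OF \<Omega> p q])
    show "rho_1p \<Omega> p u = 0 \<longleftrightarrow> u = 0" if "u \<in> W_1p \<Omega> p" for u
      using that rho_1p_eq_0_iff[OF \<Omega> p q0 q(2)] by (simp add: W_1p_def)
    show "rho_1p \<Omega> p (\<alpha> *\<^sub>R u) = rho_1p \<Omega> p u" if u: "u \<in> W_1p \<Omega> p" and \<alpha>: "\<bar>\<alpha>\<bar> = 1" for u and \<alpha> :: real
    proof (rule antisym)
      show "rho_1p \<Omega> p (\<alpha> *\<^sub>R u) \<le> rho_1p \<Omega> p u"
        using \<alpha> by (intro rho_1p_scaleR_le[OF \<Omega> p q0 q(2) diff[OF u]]) auto
      have "\<alpha> *\<^sub>R u \<in> W_1p \<Omega> p" using sub u by (rule subspace_scale)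
      then have "rho_1p \<Omega> p (\<alpha> *\<^sub>R (\<alpha> *\<^sub>R u)) \<le> rho_1p \<Omega> p (\<alpha> *\<^sub>R u)"
        using \<alpha> by (intro rho_1p_scaleR_le[OF \<Omega> p q0 q(2) diff]) auto
      moreover have "\<alpha> * \<alpha> = 1" using \<alpha> by (metis abs_mult_self_eq mult_1)
      ultimately show "rho_1p \<Omega> p u \<le> rho_1p \<Omega> p (\<alpha> *\<^sub>R u)" by simp
    qed
    show "rho_1p \<Omega> p (\<alpha> *\<^sub>R u + (1 - \<alpha>) *\<^sub>R v)
        \<le> ennreal \<alpha> * rho_1p \<Omega> p u + ennreal (1 - \<alpha>) * rho_1p \<Omega> p v"
      if "u \<in> W_1p \<Omega> p" "v \<in> W_1p \<Omega> p" "\<alpha> \<in> {0..1}" for u v \<alpha>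
      using that by (intro rho_1p_convex[OF \<Omega> p q] diff) auto
  qed
qed

lemma UC_star_rho_1p:
  fixes \<Omega> :: "'a::euclidean_space set"
  assumes \<Omega>: "open \<Omega>" and p: "p \<in> borel_measurable (lebesgue_on \<Omega>)"
    and q: "1 < q" "\<And>x. x \<in> \<Omega> \<Longrightarrow> q \<le> p x"
  shows "UC_star (W_1p \<Omega> p) (rho_1p \<Omega> p)"
proof (rule UC_star_of_modulus_inequality)
  fix \<epsilon> :: real
  assume \<epsilon>: "0 < \<epsilon>"
  show "\<exists>\<delta>>0. \<forall>u\<in>W_1p \<Omega> p. \<forall>v\<in>W_1p \<Omega> p.
      rho_1p \<Omega> p ((u + v) /\<^sub>R 2) + ennreal \<delta> * rho_1p \<Omega> p ((u - v) /\<^sub>R 2)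
      \<le> ennreal (1 + \<delta> * \<epsilon>) * ((rho_1p \<Omega> p u + rho_1p \<Omega> p v) / 2)"
  proof (intro exI[of _ "convexity_gain q \<epsilon>"] conjI ballI)
    show "0 < convexity_gain q \<epsilon>" by (rule convexity_gain_pos[OF q(1) \<epsilon>])
  qed (rule rho_1p_uniformly_convex[OF \<Omega> p q _ _ \<epsilon>]; simp add: W_1p_def)
qed

theorem corollary5p6:
  fixes \<Omega> :: "(real ^ 'n) set" and p :: "real ^ 'n \<Rightarrow> real"
  assumes "open \<Omega>" and "connected \<Omega>" and "\<Omega> \<noteq> {}" and "bounded \<Omega>"
    and "Ck_boundary 2 \<Omega>"
    and "p \<in> borel_measurable (lebesgue_on \<Omega>)"
    and "1 < (INF x\<in>\<Omega>. ereal (p x))"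
  shows "convex_modular (W_1p \<Omega> p) (rho_1p \<Omega> p) \<and>
    UC_star (W_1p \<Omega> p) (rho_1p \<Omega> p) \<and>
    (\<forall>u\<in>W_1p \<Omega> p. \<forall>v\<in>W_1p \<Omega> p. u \<noteq> v \<and> rho_1p \<Omega> p ((u + v) /\<^sub>R 2) < \<infinity> \<longrightarrow>
       rho_1p \<Omega> p ((u + v) /\<^sub>R 2) < (rho_1p \<Omega> p u + rho_1p \<Omega> p v) / 2)"
proof -
  obtain q where q: "1 < ereal q" "ereal q < (INF x\<in>\<Omega>. ereal (p x))"
    using ereal_dense2[OF assms(7)] by blast
  have q1: "1 < q" using q(1) by (simp add: one_ereal_def)
  have q_le: "q \<le> p x" if "x \<in> \<Omega>" for x
    using less_le_trans[OF q(2) INF_lower[OF that]] by simp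
  have modular: "convex_modular (W_1p \<Omega> p) (rho_1p \<Omega> p)"
    using q1 q_le by (intro convex_modular_rho_1p[OF assms(1,6), of q]) auto
  have UC: "UC_star (W_1p \<Omega> p) (rho_1p \<Omega> p)"
    by (rule UC_star_rho_1p[OF assms(1,6) q1 q_le])
  show ?thesis
    using modular UC UC_star_imp_strictly_convex[OF modular UC] by blast
qed

end
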